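(* Let $b\ge 2$ and $s\ge 1$ be integers. Let $\mathcal{P}$ be a digital net over $\mathbb{Z}_b$ in $G^s$, let $\mathcal{P}^{\perp}\subset\mathbb{N}_0^s$ be its dual net, and let $\mathcal{P}^{\mathrm{sym}}$ be the symmetrized point set of $\mathcal{P}$. Let $K:[0,1]^s\times[0,1]^s\to\mathbb{R}$ be a continuous reproducing kernel which satisfies $$\int_{[0,1]^s}\sqrt{K(\boldsymbol{x},\boldsymbol{x})}\,\mathrm{d}\boldsymbol{x}<\infty\quad\text{and}\quad \sum_{\boldsymbol{k}\in\mathbb{N}_0^s}|\hat{K}(\boldsymbol{k},\boldsymbol{k})|<\infty.$$ Then the mean square worst-case error of quasi-Monte Carlo integration over $\pi(\mathcal{P}^{\mathrm{sym}})$ with respect to a random digital shift is given by $$\tilde{e}^2(\pi(\mathcal{P}^{\mathrm{sym}}),K)=\sum_{\boldsymbol{k}\in(\mathcal{P}^{\perp}\cap\mathcal{E}^s)\setminus\{\boldsymbol{0}\}}\hat{K}(\boldsymbol{k},\boldsymbol{k}).$$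
   Context: $\mathbb{N}$ is the set of positive integers, $\mathbb{N}_0=\mathbb{N}\cup\{0\}$, and $\mathbb{Z}_b=\{0,1,\dots,b-1\}$ with arithmetic modulo $b$. Put $G=(\mathbb{Z}_b)^{\mathbb{N}}$, a compact abelian group under componentwise addition $\oplus$ (also used for $G^s$). The projection $\pi:G\to[0,1]$ is $\pi(\zeta_1,\zeta_2,\dots)=\sum_{i\ge1}\zeta_i b^{-i}$. Each $x\in[0,1)$ has its unique $b$-adic expansion $x=\sum_{i\ge1}\xi_i b^{-i}$ with infinitely many $\xi_i\ne b-1$; for $x=1$ all $\xi_i=b-1$. The section map $\sigma:[0,1]\to G$ is $\sigma(x)=(\xi_1,\xi_2,\dots)$. Both $\pi$ and $\sigma$ are applied componentwise in dimension $s$. For $\boldsymbol{x},\boldsymbol{y}\in[0,1]^s$, $\boldsymbol{x}\oplus\boldsymbol{y}:=\pi[\sigma(\boldsymbol{x})\oplus\sigma(\boldsymbol{y})]$. Walsh functions: let $\omega_b=\exp(2\pi\sqrt{-1}/b)$. For $k=\kappa_0+\kappa_1b+\dots+\kappa_{a-1}b^{a-1}\in\mathbb{N}_0$ with $\kappa_i\in\mathbb{Z}_b$, $\mathrm{wal}_k(x)=\omega_b^{\kappa_0\xi_1+\dots+\kappa_{a-1}\xi_a}$, and $\mathrm{wal}_{\boldsymbol{k}}(\boldsymbol{x})=\prod_{j=1}^s\mathrm{wal}_{k_j}(x_j)$. The Walsh coefficients of $K$ are $\hat K(\boldsymbol{k},\boldsymbol{l})=\int_{[0,1]^{2s}}K(\boldsymbol{x},\boldsymbol{y})\overline{\mathrm{wal}_{\boldsymbol{k}}(\boldsymbol{x})}\mathrm{wal}_{\boldsymbol{l}}(\boldsymbol{y})\,\mathrm{d}\boldsymbol{x}\,\mathrm{d}\boldsymbol{y}$.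 Digital net in $G^s$: given $m\in\mathbb{N}$ and matrices $C_1,\dots,C_s\in\mathbb{Z}_b^{\mathbb{N}\times m}$, for $0\le n<b^m$ with $n=\sum_{i=0}^{m-1}\nu_ib^i$, $\nu_i\in\mathbb{Z}_b$, put $\boldsymbol{z}_n=(z_{n,1},\dots,z_{n,s})\in G^s$ with $z_{n,j}=(\nu_0,\dots,\nu_{m-1})\cdot C_j^{\top}$ (over $\mathbb{Z}_b$). Then $\mathcal{P}=\{\boldsymbol{z}_0,\dots,\boldsymbol{z}_{b^m-1}\}$ is the digital net over $\mathbb{Z}_b$ in $G^s$ with generating matrices $C_1,\dots,C_s$. All point sets are counted with multiplicity. Its dual net is $\mathcal{P}^{\perp}=\{\boldsymbol{k}\in\mathbb{N}_0^s:\vec{k}_1C_1\oplus\dots\oplus\vec{k}_sC_s=(0,\dots,0)\in\mathbb{Z}_b^m\}$, where $\vec{k}_j=(\kappa_{j,0},\kappa_{j,1},\dots)$ is the (finitely supported) row vector of $b$-adic digits of $k_j=\kappa_{j,0}+\kappa_{j,1}b+\cdots$. Symmetrization: for $l\in\mathbb{Z}_b$ let $e_l=(l,l,\dots)\in G$, and for $\boldsymbol{l}\in\mathbb{Z}_b^s$ let $\boldsymbol{e}_{\boldsymbol{l}}=(e_{l_1},\dots,e_{l_s})$. Then $\mathcal{P}^{\mathrm{sym}}=\{\boldsymbol{z}\oplus\boldsymbol{e}_{\boldsymbol{l}}:\boldsymbol{z}\in\mathcal{P},\boldsymbol{l}\in\mathbb{Z}_b^s\}$, counted with multiplicity so that $|\mathcal{P}^{\mathrm{sym}}|=b^s|\mathcal{P}|$.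 $\mathcal{E}=\{k\in\mathbb{N}_0:\delta(k)\equiv0\pmod b\}$, where $\delta(k)=\kappa_0+\kappa_1+\cdots$ is the $b$-adic digit sum of $k=\kappa_0+\kappa_1b+\cdots$. Errors: for a finite point set $P\subset[0,1]^s$ (counted with multiplicity) and the reproducing kernel Hilbert space $\mathcal{H}$ of functions on $[0,1]^s$ with kernel $K$, $e(P,K)=\sup_{f\in\mathcal{H},\|f\|_{\mathcal{H}}\le1}\left|\int_{[0,1]^s}f(\boldsymbol{x})\,\mathrm{d}\boldsymbol{x}-\frac1{|P|}\sum_{\boldsymbol{x}\in P}f(\boldsymbol{x})\right|$ and $e^2(P,K)=(e(P,K))^2$. The mean square worst-case error with respect to a random digital shift is $\tilde e^2(P,K)=\int_{[0,1]^s}e^2(P\oplus\boldsymbol{\sigma},K)\,\mathrm{d}\boldsymbol{\sigma}$, where $P\oplus\boldsymbol{\sigma}=\{\boldsymbol{x}\oplus\boldsymbol{\sigma}:\boldsymbol{x}\in P\}$ for a shift vector $\boldsymbol{\sigma}\in[0,1]^s$.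
   Formalization: As literally defined the formula can fail; it is proved with the digital shift applied to the points of P^sym in G^s before projecting by π, and for the literal shift of π(P^sym) only when σ(π(z)) = z for every z in P^sym. *)

theory Defs
  imports "HOL-Analysis.Analysis" "HOL-Library.Multiset"
begin

text \<open>
  An element of the group $G$ of sequences over $Z_b$ is a function \<open>nat \<Rightarrow> nat\<close> with values
  below \<open>b\<close>. Positions are counted from 0: the value at \<open>i\<close> is the digit $\zeta_{i+1}$, which has
  weight $b^{-(i+1)}$. The dimension $s$ is \<open>CARD('s)\<close>, and finite point sets counted with
  multiplicity are multisets.
\<close>

definition unit_cube :: "(real^'s) set" where
  "unit_cube = cbox 0 1"

definition seq_add :: "nat \<Rightarrow> (nat \<Rightarrow> nat) \<Rightarrow> (nat \<Rightarrow> nat) \<Rightarrow> (nat \<Rightarrow> nat)" where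
  "seq_add b z w = (\<lambda>i. (z i + w i) mod b)"

definition seq_proj :: "nat \<Rightarrow> (nat \<Rightarrow> nat) \<Rightarrow> real" where
  "seq_proj b z = (\<Sum>i. real (z i) / real b ^ Suc i)"

definition seq_sect :: "nat \<Rightarrow> real \<Rightarrow> (nat \<Rightarrow> nat)" where
  "seq_sect b x =
     (if x = 1 then (\<lambda>i. b - 1)
      else (THE \<xi>. (\<forall>i. \<xi> i < b) \<and> infinite {i. \<xi> i \<noteq> b - 1} \<and>
                   (\<lambda>i. real (\<xi> i) / real b ^ Suc i) sums x))"

definition vec_add :: "nat \<Rightarrow> (nat \<Rightarrow> nat)^'s \<Rightarrow> (nat \<Rightarrow> nat)^'s \<Rightarrow> (nat \<Rightarrow> nat)^'s" where
  "vec_add b z w = (\<chi> j. seq_add b (z $ j) (w $ j))"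

definition vec_proj :: "nat \<Rightarrow> (nat \<Rightarrow> nat)^'s \<Rightarrow> real^'s" where
  "vec_proj b z = (\<chi> j. seq_proj b (z $ j))"

definition vec_sect :: "nat \<Rightarrow> real^'s \<Rightarrow> (nat \<Rightarrow> nat)^'s" where
  "vec_sect b x = (\<chi> j. seq_sect b (x $ j))"

definition dig_add :: "nat \<Rightarrow> real^'s \<Rightarrow> real^'s \<Rightarrow> real^'s" where
  "dig_add b x y = vec_proj b (vec_add b (vec_sect b x) (vec_sect b y))"


definition nat_digit :: "nat \<Rightarrow> nat \<Rightarrow> nat \<Rightarrow> nat" where
  "nat_digit b k i = (k div b ^ i) mod b"

text \<open>All sums over digits below range over the finitely many positions with a nonzero digit.\<close>

definition nat_digit_supp :: "nat \<Rightarrow> nat \<Rightarrow> nat set" where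
  "nat_digit_supp b k = {i. nat_digit b k i \<noteq> 0}"

definition wal :: "nat \<Rightarrow> nat \<Rightarrow> real \<Rightarrow> complex" where
  "wal b k x = exp (2 * of_real pi * \<i> / of_nat b) ^
     (\<Sum>i\<in>nat_digit_supp b k. nat_digit b k i * seq_sect b x i)"

definition vec_wal :: "nat \<Rightarrow> nat^'s \<Rightarrow> real^'s \<Rightarrow> complex" where
  "vec_wal b k x = (\<Prod>j\<in>UNIV. wal b (k $ j) (x $ j))"

definition walsh_coeff ::
  "nat \<Rightarrow> (real^'s \<Rightarrow> real^'s \<Rightarrow> real) \<Rightarrow> nat^'s \<Rightarrow> nat^'s \<Rightarrow> complex" where
  "walsh_coeff b K k l =
     (LINT p:unit_cube \<times> unit_cube|lborel.
        of_real (K (fst p) (snd p)) * cnj (vec_wal b k (fst p)) * vec_wal b l (snd p))"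


text \<open>
  The generating matrix \<open>C $ j\<close> has infinitely many rows: \<open>(C $ j) i r\<close> is its entry in row \<open>i\<close> and
  column \<open>r < m\<close>.
\<close>

definition net_point :: "nat \<Rightarrow> nat \<Rightarrow> (nat \<Rightarrow> nat \<Rightarrow> nat)^'s \<Rightarrow> nat \<Rightarrow> (nat \<Rightarrow> nat)^'s" where
  "net_point b m C n = (\<chi> j. (\<lambda>i. (\<Sum>r<m. nat_digit b n r * (C $ j) i r) mod b))"

definition digital_net :: "nat \<Rightarrow> nat \<Rightarrow> (nat \<Rightarrow> nat \<Rightarrow> nat)^'s \<Rightarrow> ((nat \<Rightarrow> nat)^'s) multiset" where
  "digital_net b m C = image_mset (net_point b m C) (mset_set {..<b ^ m})"

definition dual_net :: "nat \<Rightarrow> nat \<Rightarrow> (nat \<Rightarrow> nat \<Rightarrow> nat)^'s \<Rightarrow> (nat^'s) set" where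
  "dual_net b m C =
     {k. \<forall>r<m. (\<Sum>j\<in>UNIV. \<Sum>i\<in>nat_digit_supp b (k $ j).
                   nat_digit b (k $ j) i * (C $ j) i r) mod b = 0}"

definition const_vec :: "nat^'s \<Rightarrow> (nat \<Rightarrow> nat)^'s" where
  "const_vec l = (\<chi> j. (\<lambda>i. l $ j))"

definition symmetrize :: "nat \<Rightarrow> ((nat \<Rightarrow> nat)^'s) multiset \<Rightarrow> ((nat \<Rightarrow> nat)^'s) multiset" where
  "symmetrize b P =
     (\<Sum>z\<in>#P. image_mset (\<lambda>l. vec_add b z (const_vec l)) (mset_set {l. \<forall>j. l $ j < b}))"

definition digit_sum :: "nat \<Rightarrow> nat \<Rightarrow> nat" where
  "digit_sum b k = (\<Sum>i\<in>nat_digit_supp b k. nat_digit b k i)"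

definition even_digit_sum :: "nat \<Rightarrow> nat set" where
  "even_digit_sum b = {k. digit_sum b k mod b = 0}"


text \<open>
  A Hilbert space \<open>H\<close> of real functions on \<open>D\<close>, with inner product \<open>ip\<close>, in which \<open>K\<close> reproduces
  point evaluations. Functions on \<open>D\<close> are represented by their extensional representatives, so that
  equality in \<open>H\<close> is equality on \<open>D\<close>.
\<close>

locale rkhs =
  fixes D :: "'a set"
    and H :: "('a \<Rightarrow> real) set"
    and ip :: "('a \<Rightarrow> real) \<Rightarrow> ('a \<Rightarrow> real) \<Rightarrow> real"
    and K :: "'a \<Rightarrow> 'a \<Rightarrow> real"
  assumes extensional: "H \<subseteq> extensional D"
    and zero_mem: "(\<lambda>x\<in>D. 0) \<in> H"
    and add_mem: "\<lbrakk>f \<in> H; g \<in> H\<rbrakk> \<Longrightarrow> (\<lambda>x\<in>D. f x + g x) \<in> H"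
    and scale_mem: "f \<in> H \<Longrightarrow> (\<lambda>x\<in>D. c * f x) \<in> H"
    and ip_commute: "\<lbrakk>f \<in> H; g \<in> H\<rbrakk> \<Longrightarrow> ip f g = ip g f"
    and ip_add: "\<lbrakk>f \<in> H; g \<in> H; h \<in> H\<rbrakk> \<Longrightarrow> ip (\<lambda>x\<in>D. f x + g x) h = ip f h + ip g h"
    and ip_scale: "\<lbrakk>f \<in> H; h \<in> H\<rbrakk> \<Longrightarrow> ip (\<lambda>x\<in>D. c * f x) h = c * ip f h"
    and ip_nonneg: "f \<in> H \<Longrightarrow> 0 \<le> ip f f"
    and ip_definite: "\<lbrakk>f \<in> H; ip f f = 0\<rbrakk> \<Longrightarrow> f = (\<lambda>x\<in>D. 0)"
    and complete: "Metric_space.mcomplete H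
          (\<lambda>f g. sqrt (ip (\<lambda>x\<in>D. f x - g x) (\<lambda>x\<in>D. f x - g x)))"
    and kernel_mem: "y \<in> D \<Longrightarrow> (\<lambda>x\<in>D. K x y) \<in> H"
    and reproducing: "\<lbrakk>f \<in> H; y \<in> D\<rbrakk> \<Longrightarrow> ip f (\<lambda>x\<in>D. K x y) = f y"

definition wc_error ::
  "(real^'s \<Rightarrow> real) set \<Rightarrow> ((real^'s \<Rightarrow> real) \<Rightarrow> (real^'s \<Rightarrow> real) \<Rightarrow> real) \<Rightarrow>
   (real^'s) multiset \<Rightarrow> real" where
  "wc_error H ip P =
     (SUP f\<in>{f \<in> H. sqrt (ip f f) \<le> 1}.
        \<bar>(LINT x:unit_cube|lborel. f x) - 1 / real (size P) * (\<Sum>x\<in>#P. f x)\<bar>)"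

definition ms_error ::
  "nat \<Rightarrow> (real^'s \<Rightarrow> real) set \<Rightarrow> ((real^'s \<Rightarrow> real) \<Rightarrow> (real^'s \<Rightarrow> real) \<Rightarrow> real) \<Rightarrow>
   (real^'s) multiset \<Rightarrow> real" where
  "ms_error b H ip P =
     (LINT y:unit_cube|lborel. (wc_error H ip (image_mset (\<lambda>x. dig_add b x y) P))\<^sup>2)"

text \<open>
  The mean square error of the projection of a point set \<open>Q\<close> in $G^s$, where the shift acts on the
  digit sequences \<open>z\<close> themselves before they are projected. It is \<open>ms_error b H ip\<close> of the projected
  point set whenever \<open>vec_sect b (vec_proj b z) = z\<close> for all points \<open>z\<close> of \<open>Q\<close>. A sequence ending in
  digits \<open>b - 1\<close> (and not constant) violates this condition, since \<open>vec_sect\<close> after \<open>vec_proj\<close>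
  replaces it by the terminating expansion of the same number, whose digital shifts are different.
\<close>

definition ms_error_seq ::
  "nat \<Rightarrow> (real^'s \<Rightarrow> real) set \<Rightarrow> ((real^'s \<Rightarrow> real) \<Rightarrow> (real^'s \<Rightarrow> real) \<Rightarrow> real) \<Rightarrow>
   ((nat \<Rightarrow> nat)^'s) multiset \<Rightarrow> real" where
  "ms_error_seq b H ip Q =
     (LINT y:unit_cube|lborel.
        (wc_error H ip (image_mset (\<lambda>z. vec_proj b (vec_add b z (vec_sect b y))) Q))\<^sup>2)"

end

theory Submission
  imports Defs
begin

text \<open>
  For a shift $y$, the squared worst-case error is the squared norm
  of the functional \<open>f \<mapsto> \<integral>f - mean of f over the shifted points\<close>, hence a quadratic expression in the kernel.
  Averaging it over $y$ makes every term translation invariant. The three terms that involve an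
  integral of $K$ combine to $-\int\int K = -\hat K(0,0)$, and the last term is the mean over all pairs
  of points $z, w$ of $\int K(z \oplus y, w \oplus y)\,dy$. As a function of $z$ and $w$ this integral has the
  absolutely convergent Walsh series $\sum_k \hat K(k,k)\,\mathrm{wal}_k(z)\overline{\mathrm{wal}_k(w)}$.
  So every finite point set satisfies
  \<open>mean square error = \<Sum>k\<noteq>0. K^(k,k) * |mean of wal_k over the points|\<^sup>2\<close>, which is
  \<open>mean_square_error_formula\<close>. For the symmetrized net the mean of the $k$-th character factors into a
  character sum over the net and one over the constant shifts; it is 1 if $k$ lies in the dual net and
  all digit sums vanish modulo $b$, and 0 otherwise (\<open>sum_vchr_net\<close>, \<open>sum_vchr_const\<close>).

  The analysis is done by discretization, which replaces Haar measure, Fubini's theorem and the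
  representer of the integral by finite sums. Let \<open>grid n\<close> be the finite group of digit vectors that
  vanish from position $n$ on. The cube splits into cells of equal volume, one for each element of the
  grid: the points with prescribed first $n$ digits. If functions of these $n$ digits converge
  uniformly to $g$, then $g$ is integrable and their grid averages converge to its integral
  (\<open>uniform_step_limit\<close>). Truncating digits moves a point by at most $b^{-n}$ in each coordinate, so the
  uniform continuity of $K$ provides all the uniform convergence needed. In particular the unit ball of
  the Hilbert space is uniformly equicontinuous (\<open>function_modulus\<close>), so the error functional is the
  norm limit of finite combinations of point evaluations, whose norms are explicit
  (\<open>shifted_error_approx\<close>).

  On the grid both sides become elementary. The averaged squared error is a difference of two grid
  averages of $K$, because translations permute the grid (\<open>sq_error_sum\<close>). The partial sum of the Walsh
  series over all $k$ with $k_j < b^n$ is, by orthogonality of the characters, the integral of $K$ against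
  a probability density that depends only on the first $n$ digits (\<open>walsh_partial_sum\<close>), and replacing
  $K$ by its step approximation turns that integral into the same grid average
  (\<open>pair_mean_approx\<close>). Letting $n$ tend to infinity gives the formula.
\<close>

section \<open>Digit expansions of real numbers\<close>

locale digit_base =
  fixes b :: nat
  assumes b2: "2 \<le> b"
begin

definition digits :: "(nat \<Rightarrow> nat) \<Rightarrow> bool" where
  "digits u \<longleftrightarrow> (\<forall>i. u i < b)"

text \<open>
  The geometric series behind $0.999\ldots = 1$: it bounds every digit expansion, and it is the reason why
  the section of $1$ may consist of the digits $b - 1$ only.
\<close>

lemma top_digit_sums: "(\<lambda>i. real (b - 1) / real b ^ Suc i) sums 1"
proof -
  have "(\<lambda>i. (1 / real b) ^ i) sums (1 / (1 - 1 / real b))"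
    using b2 by (intro geometric_sums) auto
  then have "(\<lambda>i. (real (b - 1) / real b) * (1 / real b) ^ i) sums
      ((real (b - 1) / real b) * (1 / (1 - 1 / real b)))"
    by (rule sums_mult)
  moreover have "(real (b - 1) / real b) * (1 / (1 - 1 / real b)) = 1"
    using b2 by (simp add: field_simps of_nat_diff)
  moreover have "(real (b - 1) / real b) * (1 / real b) ^ i = real (b - 1) / real b ^ Suc i" for i
    by (simp add: power_one_over)
  ultimately show ?thesis by (simp only:)
qed

lemma digits_le: "digits u \<Longrightarrow> u i \<le> b - 1"
proof -
  assume "digits u"
  then have "u i < b" by (simp add: digits_def)
  then show "u i \<le> b - 1" by linarith
qed

lemma digit_term_le:
  assumes "digits u"
  shows "real (u i) / real b ^ Suc i \<le> real (b - 1) / real b ^ Suc i"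
  using digits_le[OF assms, of i] by (intro divide_right_mono) simp_all

lemma seq_proj_summable: 
  assumes "digits u"
  shows "summable (\<lambda>i. real (u i) / real b ^ Suc i)"
proof (rule summable_comparison_test'[OF sums_summable[OF top_digit_sums], of 0])
  show "norm (real (u i) / real b ^ Suc i) \<le> real (b - 1) / real b ^ Suc i" for i
    using digit_term_le[OF assms, of i] by simp
qed

lemma seq_proj_nonneg: "digits u \<Longrightarrow> 0 \<le> seq_proj b u"
  unfolding seq_proj_def by (intro suminf_nonneg seq_proj_summable) auto

lemma seq_proj_top: "seq_proj b (\<lambda>i. b - 1) = 1"
  unfolding seq_proj_def by (rule sums_unique[symmetric, OF top_digit_sums])

lemma seq_proj_le_1: 
  assumes "digits u" shows "seq_proj b u \<le> 1"
proof -
  have "seq_proj b u \<le> (\<Sum>i. real (b - 1) / real b ^ Suc i)"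
    unfolding seq_proj_def
    by (intro suminf_le digit_term_le seq_proj_summable assms sums_summable[OF top_digit_sums])
  then show ?thesis using sums_unique[OF top_digit_sums] by simp
qed

lemma seq_proj_less_1:
  assumes "digits u" "u i \<noteq> b - 1" shows "seq_proj b u < 1"
proof -
  have "u i < b - 1" using digits_le[OF assms(1), of i] assms(2) by simp
  then have "real (u i) / real b ^ Suc i < real (b - 1) / real b ^ Suc i"
    using b2 by (intro divide_strict_right_mono) auto
  then have "0 < (\<Sum>i. real (b - 1) / real b ^ Suc i - real (u i) / real b ^ Suc i)"
    by (intro suminf_pos2 [of _ i] summable_diff seq_proj_summable assms sums_summable[OF top_digit_sums])
       (use digit_term_le[OF assms(1)] in auto)
  also have "\<dots> = 1 - seq_proj b u"
    unfolding seq_proj_def sums_unique[OF top_digit_sums]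
    by (intro suminf_diff[symmetric] seq_proj_summable assms sums_summable[OF top_digit_sums])
  finally show ?thesis by simp
qed

lemma seq_proj_split:
  assumes "digits u"
  shows "seq_proj b u = (\<Sum>i<n. real (u i) / real b ^ Suc i) + seq_proj b (\<lambda>i. u (i + n)) / real b ^ n"
proof -
  have "seq_proj b u = (\<Sum>i. real (u (i + n)) / real b ^ Suc (i + n)) + (\<Sum>i<n. real (u i) / real b ^ Suc i)"
    unfolding seq_proj_def by (rule suminf_split_initial_segment[OF seq_proj_summable[OF assms]])
  moreover have "digits (\<lambda>i. u (i + n))" using assms by (simp add: digits_def)
  from suminf_divide[OF seq_proj_summable[OF this], of "real b ^ n"]
  have "(\<Sum>i. real (u (i + n)) / real b ^ Suc (i + n)) = seq_proj b (\<lambda>i. u (i + n)) / real b ^ n"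
    by (simp add: seq_proj_def power_add mult.assoc)
  ultimately show ?thesis by simp
qed

text \<open>
  At the first difference $v$ gains at least one unit of that position, and all later digits of $u$
  together are worth at most one such unit, with equality only if they all equal $b - 1$.
\<close>

lemma seq_proj_lex_le:
  assumes "digits u" "digits v" "\<And>k. k < i \<Longrightarrow> u k = v k" "u i < v i"
  shows "seq_proj b u \<le> seq_proj b v"
    and "infinite {k. u k \<noteq> b - 1} \<Longrightarrow> seq_proj b u < seq_proj b v"
proof -
  define S where "S = (\<Sum>k<i. real (u k) / real b ^ Suc k)"
  have S: "S = (\<Sum>k<i. real (v k) / real b ^ Suc k)"
    unfolding S_def using assms(3) by (intro sum.cong) auto
  define u' where "u' = (\<lambda>k. u (k + Suc i))"
  have du': "digits u'" and dv: "digits (\<lambda>k. v (k + Suc i))"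
    using assms by (auto simp: digits_def u'_def)
  have u: "seq_proj b u = S + (real (u i) + seq_proj b u') / real b ^ Suc i"
    by (subst seq_proj_split[OF assms(1), of "Suc i"]) (simp add: S_def u'_def add_divide_distrib)
  have v: "seq_proj b v = S + (real (v i) + seq_proj b (\<lambda>k. v (k + Suc i))) / real b ^ Suc i"
    by (subst seq_proj_split[OF assms(2), of "Suc i"]) (simp add: S add_divide_distrib)
  have 1: "real (u i) + 1 \<le> real (v i) + seq_proj b (\<lambda>k. v (k + Suc i))"
    using seq_proj_nonneg[OF dv] assms(4) by linarith
  show "seq_proj b u \<le> seq_proj b v"
    unfolding u v using 1 seq_proj_le_1[OF du'] b2
    by (intro add_left_mono divide_right_mono) auto
  assume "infinite {k. u k \<noteq> b - 1}"
  then obtain k where "k > i" "u k \<noteq> b - 1"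
    by (metis (mono_tags, lifting) finite_nat_set_iff_bounded_le linorder_le_less_linear mem_Collect_eq)
  then have "u' (k - Suc i) \<noteq> b - 1" by (simp add: u'_def)
  then have "seq_proj b u' < 1" using du' seq_proj_less_1 by blast
  then show "seq_proj b u < seq_proj b v"
    unfolding u v using 1 b2
    by (intro add_strict_left_mono divide_strict_right_mono) auto
qed

lemma first_difference:
  assumes "u \<noteq> (v :: nat \<Rightarrow> nat)"
  obtains i where "\<And>k. k < i \<Longrightarrow> u k = v k" "u i < v i" | i where "\<And>k. k < i \<Longrightarrow> v k = u k" "v i < u i"
proof -
  define i where "i = (LEAST i. u i \<noteq> v i)"
  have "\<exists>i. u i \<noteq> v i" using assms by auto
  then have "u i \<noteq> v i" unfolding i_def by (rule LeastI_ex)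
  moreover have "u k = v k" if "k < i" for k using not_less_Least[of k "\<lambda>i. u i \<noteq> v i"] that
    unfolding i_def by blast
  ultimately show thesis using that[of i] by (cases "u i < v i") auto
qed

text \<open>
  Cutting off the expansion after $n$ digits is rounding down to a multiple of $b^{-n}$; this holds because
  \<open>\<lfloor>x b^n\<rfloor> = \<lfloor>x b^(n+1)\<rfloor> div b\<close>.
\<close>

lemma floor_digits:
  fixes x :: real
  assumes "0 \<le> x" "x < 1"
  defines "e \<equiv> \<lambda>i. nat \<lfloor>x * real b ^ Suc i\<rfloor> mod b"
  shows "(\<Sum>i<n. real (e i) / real b ^ Suc i) = of_int \<lfloor>x * real b ^ n\<rfloor> / real b ^ n"
proof (induction n)
  case 0
  then show ?case using assms by (simp add: floor_eq_iff)
next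
  case (Suc n)
  define f where "f = \<lfloor>x * real b ^ Suc n\<rfloor>"
  have f0: "0 \<le> f" using assms by (simp add: f_def)
  have "x * real b ^ n = x * real b ^ Suc n / real_of_int (int b)" using b2 by simp
  then have "\<lfloor>x * real b ^ n\<rfloor> = f div int b" unfolding f_def 
    by (metis floor_divide_real_eq_div of_nat_0_le_iff)
  moreover have "int (e n) = f mod int b" unfolding e_def f_def[symmetric] using f0
    by (simp add: zmod_int)
  then have "real (e n) = of_int (f mod int b)" by (metis of_int_of_nat_eq)
  moreover have "f = int b * (f div int b) + f mod int b" by simp
  then have "real_of_int f = real b * of_int (f div int b) + of_int (f mod int b)"
    by (metis of_int_add of_int_mult of_int_of_nat_eq)
  ultimately show ?case using Suc b2 unfolding f_def[symmetric] by (simp add: field_simps)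
qed

text \<open>
  The definite description in \<open>seq_sect\<close> is justified here. The digits obtained by rounding down form
  an admissible expansion: a tail of digits $b - 1$ would make $x$ equal to the upper end of the half-open
  interval in which rounding down has located it. Any two admissible expansions agree by the strict form of \<open>seq_proj_lex_le\<close>.
\<close>

lemma seq_sect_floor:
  assumes "0 \<le> x" "x < 1"
  shows "seq_sect b x = (\<lambda>i. nat \<lfloor>x * real b ^ Suc i\<rfloor> mod b)"
    and "(\<lambda>i. real (nat \<lfloor>x * real b ^ Suc i\<rfloor> mod b) / real b ^ Suc i) sums x"
proof -
  \<comment> \<open>e: the candidate digits; E: the property in the definite description\<close>
  define e where "e = (\<lambda>i. nat \<lfloor>x * real b ^ Suc i\<rfloor> mod b)"
  define E where "E \<xi> \<longleftrightarrow> (\<forall>i. \<xi> i < b) \<and> infinite {i. \<xi> i \<noteq> b - 1} \<and>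
                   (\<lambda>i. real (\<xi> i) / real b ^ Suc i) sums x" for \<xi>
  have de: "digits e" using b2 by (auto simp: digits_def e_def)
  have part: "(\<Sum>i<n. real (e i) / real b ^ Suc i) = of_int \<lfloor>x * real b ^ n\<rfloor> / real b ^ n" for n
    unfolding e_def by (rule floor_digits[OF assms])
  have lo: "(\<Sum>i<n. real (e i) / real b ^ Suc i) \<le> x"
    and hi: "x < (\<Sum>i<n. real (e i) / real b ^ Suc i) + 1 / real b ^ n" for n
  proof -
    have "of_int \<lfloor>x * real b ^ n\<rfloor> \<le> x * real b ^ n" "x * real b ^ n < of_int \<lfloor>x * real b ^ n\<rfloor> + 1"
      by linarith+
    then show "(\<Sum>i<n. real (e i) / real b ^ Suc i) \<le> x" 
      "x < (\<Sum>i<n. real (e i) / real b ^ Suc i) + 1 / real b ^ n"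
      unfolding part using b2 by (simp_all add: field_simps)
  qed
  have lim0: "(\<lambda>n. 1 / real b ^ n) \<longlonglongrightarrow> 0"
    using b2 LIMSEQ_power_zero[of "1 / real b"] by (simp add: power_one_over)
  have sums: "(\<lambda>i. real (e i) / real b ^ Suc i) sums x"
    unfolding sums_def
  proof (rule real_tendsto_sandwich[OF _ _ _ tendsto_const])
    show "(\<lambda>n. x - 1 / real b ^ n) \<longlonglongrightarrow> x" using tendsto_diff[OF tendsto_const lim0, of x] by simp
    show "\<forall>\<^sub>F n in sequentially. x - 1 / real b ^ n \<le> (\<Sum>i<n. real (e i) / real b ^ Suc i)"
      using hi by (intro always_eventually allI) (simp add: algebra_simps less_imp_le)
  qed (use lo in auto)
  have "infinite {i. e i \<noteq> b - 1}"
  proof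
    assume "finite {i. e i \<noteq> b - 1}"
    then obtain n where "{i. e i \<noteq> b - 1} \<subseteq> {..<n}"
      using finite_nat_iff_bounded by blast
    then have "e i = b - 1" if "n \<le> i" for i using that by force
    then have "(\<lambda>i. e (i + n)) = (\<lambda>i. b - 1)" by auto
    then have "seq_proj b e = (\<Sum>i<n. real (e i) / real b ^ Suc i) + 1 / real b ^ n"
      using seq_proj_split[OF de, of n] by (simp add: seq_proj_top[unfolded One_nat_def])
    moreover have "seq_proj b e = x" using sums by (simp add: seq_proj_def sums_iff)
    ultimately show False using hi[of n] by simp
  qed
  then have Ee: "E e" using de sums by (auto simp: E_def digits_def)
  have "\<xi> = e" if "E \<xi>" for \<xi>
  proof (rule ccontr)
    assume ne: "\<xi> \<noteq> e"
    have d: "digits \<xi>" "seq_proj b \<xi> = x" "seq_proj b e = x" 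
      using that Ee by (auto simp: E_def digits_def seq_proj_def sums_iff)
    from ne show False
      by (cases rule: first_difference)
         (use seq_proj_lex_le(2)[OF d(1) de] seq_proj_lex_le(2)[OF de d(1)] that Ee d in \<open>force simp: E_def\<close>)+
  qed
  with Ee have "(THE \<xi>. E \<xi>) = e" by blast
  then show "seq_sect b x = (\<lambda>i. nat \<lfloor>x * real b ^ Suc i\<rfloor> mod b)"
    unfolding seq_sect_def E_def using assms by (simp add: e_def)
  show "(\<lambda>i. real (nat \<lfloor>x * real b ^ Suc i\<rfloor> mod b) / real b ^ Suc i) sums x"
    using sums by (simp add: e_def)
qed

lemma digits_seq_sect: "0 \<le> x \<Longrightarrow> x \<le> 1 \<Longrightarrow> digits (seq_sect b x)"
  using b2 seq_sect_floor(1)[of x] 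
  by (cases "x = 1") (auto simp: seq_sect_def digits_def)

lemma seq_proj_sect:
  assumes "0 \<le> x" "x \<le> 1"
  shows "seq_proj b (seq_sect b x) = x"
proof (cases "x = 1")
  case True
  then show ?thesis using seq_proj_top by (simp add: seq_sect_def)
next
  case False
  then show ?thesis
    using seq_sect_floor[of x] assms unfolding seq_proj_def by (metis order_le_less sums_unique)
qed

definition trunc_seq :: "nat \<Rightarrow> (nat \<Rightarrow> nat) \<Rightarrow> nat \<Rightarrow> nat" where
  "trunc_seq n u = (\<lambda>i. if i < n then u i else 0)"

lemma digits_trunc_seq: "digits u \<Longrightarrow> digits (trunc_seq n u)"
  using b2 by (auto simp: digits_def trunc_seq_def)

lemma seq_proj_trunc:
  assumes "digits u"
  shows "seq_proj b (trunc_seq n u) \<le> seq_proj b u"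
    and "seq_proj b u \<le> seq_proj b (trunc_seq n u) + 1 / real b ^ n"
proof -
  have "(\<lambda>i. trunc_seq n u (i + n)) = (\<lambda>i. 0)" by (simp add: trunc_seq_def)
  then have "seq_proj b (trunc_seq n u) = (\<Sum>i<n. real (u i) / real b ^ Suc i)"
    using seq_proj_split[OF digits_trunc_seq[OF assms], of n n]
    by (simp add: trunc_seq_def seq_proj_def)
  moreover have "digits (\<lambda>i. u (i + n))" using assms by (simp add: digits_def)
  then have "0 \<le> seq_proj b (\<lambda>i. u (i + n)) / real b ^ n"
    "seq_proj b (\<lambda>i. u (i + n)) / real b ^ n \<le> 1 / real b ^ n"
    using seq_proj_nonneg seq_proj_le_1 b2 by (auto intro!: divide_right_mono)
  ultimately show "seq_proj b (trunc_seq n u) \<le> seq_proj b u"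
    "seq_proj b u \<le> seq_proj b (trunc_seq n u) + 1 / real b ^ n"
    using seq_proj_split[OF assms, of n] by linarith+
qed

text \<open>
  Points strictly inside an elementary interval have the digits that name the interval. A digit vector
  that differs from the name below position $n$ is lexicographically separated either from the
  lower end of the interval, or from the upper end written with digits $b - 1$.
\<close>

lemma trunc_seq_sect_eqI:
  assumes x: "0 \<le> x" "x \<le> 1" and d: "digits d"
    and "seq_proj b (trunc_seq n d) < x" "x < seq_proj b (trunc_seq n d) + 1 / real b ^ n"
  shows "trunc_seq n (seq_sect b x) = trunc_seq n d"
proof (rule ccontr)
  \<comment> \<open>the upper end of the interval, expanded with a tail of digits b - 1\<close>
  define d1 where "d1 = (\<lambda>i. if i < n then d i else b - 1)"
  have dig: "digits d1" "digits (trunc_seq n d)" "digits (trunc_seq n (seq_sect b x))" "digits (seq_sect b x)"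
    using d b2 digits_seq_sect[OF x] by (auto simp: d1_def digits_def trunc_seq_def)
  have "(\<lambda>i. trunc_seq n d (i + n)) = (\<lambda>i. 0)" "(\<lambda>i. d1 (i + n)) = (\<lambda>i. b - 1)"
    by (auto simp: trunc_seq_def d1_def)
  then have d1: "seq_proj b d1 = seq_proj b (trunc_seq n d) + 1 / real b ^ n"
    using seq_proj_split[OF dig(1), of n] seq_proj_split[OF dig(2), of n] seq_proj_top
    by (simp add: d1_def trunc_seq_def seq_proj_def)
  assume "trunc_seq n (seq_sect b x) \<noteq> trunc_seq n d"
  then show False
  proof (cases rule: first_difference)
    case (1 i)
    then have "i < n" by (auto simp: trunc_seq_def split: if_splits)
    with 1 have "seq_sect b x k = trunc_seq n d k" if "k < i" for k
      using 1(1)[of k] that by (auto simp: trunc_seq_def)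
    moreover have "seq_sect b x i < trunc_seq n d i" using 1 \<open>i < n\<close> by (auto simp: trunc_seq_def)
    ultimately have "seq_proj b (seq_sect b x) \<le> seq_proj b (trunc_seq n d)"
      using seq_proj_lex_le(1)[OF dig(4) dig(2)] by blast
    then show False using assms by (simp add: seq_proj_sect)
  next
    case (2 i)
    then have "i < n" by (auto simp: trunc_seq_def split: if_splits)
    with 2 have "d1 k = seq_sect b x k" if "k < i" for k
      using 2(1)[of k] that by (auto simp: trunc_seq_def d1_def)
    moreover have "d1 i < seq_sect b x i" using 2 \<open>i < n\<close> by (auto simp: trunc_seq_def d1_def)
    ultimately have "seq_proj b d1 \<le> seq_proj b (seq_sect b x)"
      using seq_proj_lex_le(1)[OF dig(1) dig(4)] by blast
    then show False using assms d1 by (simp add: seq_proj_sect)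
  qed
qed

lemma measurable_trunc_seq_sect:
  "{x \<in> {0..1}. trunc_seq n (seq_sect b x) = d} \<in> sets borel"
proof -
  let ?e = "\<lambda>i x. nat \<lfloor>x * real b ^ Suc i\<rfloor> mod b"
  have "{x \<in> {0..<1}. trunc_seq n (seq_sect b x) = d} =
      {x \<in> {0..<1}. \<forall>i. (if i < n then ?e i x else 0) = d i}"
    using seq_sect_floor(1) by (auto simp: trunc_seq_def fun_eq_iff)
  moreover have "{x \<in> space borel. x \<in> {0..<1} \<and> (\<forall>i. (if i < n then ?e i x else 0) = d i)} \<in> sets borel"
    by measurable
  ultimately have "{x \<in> {0..<1}. trunc_seq n (seq_sect b x) = d} \<in> sets borel" by simp
  moreover have "{x \<in> {1::real}. trunc_seq n (seq_sect b x) = d} \<in> sets borel"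
    by (intro borel_closed finite_imp_closed) simp
  moreover have "{x \<in> {0..1::real}. trunc_seq n (seq_sect b x) = d} =
     {x \<in> {0..<1}. trunc_seq n (seq_sect b x) = d} \<union> {x \<in> {1}. trunc_seq n (seq_sect b x) = d}"
    by force
  ultimately show ?thesis by (simp only: sets.Un)
qed

end

section \<open>Integration by step functions on equal partitions\<close>

text \<open>
  A function that is constant on each of finitely many cells of equal measure is a finite linear
  combination of indicators.
\<close>

lemma partition_integral:
  fixes h :: "'i \<Rightarrow> 'e::{banach, second_countable_topology}"
  assumes I: "finite I" and addr: "\<And>x. x \<in> D \<Longrightarrow> s x \<in> I"
    and cell: "\<And>i. i \<in> I \<Longrightarrow> {x \<in> D. s x = i} \<in> sets M"
      "\<And>i. i \<in> I \<Longrightarrow> emeasure M {x \<in> D. s x = i} = ennreal w"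
    and w: "0 \<le> w"
  shows "set_integrable M D (\<lambda>x. h (s x))" "(LINT x:D|M. h (s x)) = w *\<^sub>R (\<Sum>i\<in>I. h i)"
proof -
  have eq: "indicator D x *\<^sub>R h (s x) = (\<Sum>i\<in>I. indicator {x \<in> D. s x = i} x *\<^sub>R h i)" for x
  proof (cases "x \<in> D")
    case True
    then have "(\<Sum>i\<in>I. indicator {x \<in> D. s x = i} x *\<^sub>R h i) = (\<Sum>i\<in>I. if s x = i then h i else 0)"
      by (intro sum.cong) (auto simp: indicator_def)
    then show ?thesis using True addr[OF True] I by simp
  qed simp
  have int: "integrable M (\<lambda>x. indicator {x \<in> D. s x = i} x *\<^sub>R h i)"
    and val: "(LINT x|M. indicator {x \<in> D. s x = i} x *\<^sub>R h i) = w *\<^sub>R h i" if "i \<in> I" for i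
  proof -
    have fin: "emeasure M {x \<in> D. s x = i} < \<infinity>" using cell(2)[OF that] by simp
    then show "integrable M (\<lambda>x. indicator {x \<in> D. s x = i} x *\<^sub>R h i)"
      using cell(1)[OF that] by (intro integrable_scaleR_left integrable_real_indicator) auto
    have "measure M {x \<in> D. s x = i} = w" using cell(2)[OF that] w by (simp add: measure_def)
    then show "(LINT x|M. indicator {x \<in> D. s x = i} x *\<^sub>R h i) = w *\<^sub>R h i"
      using fin cell(1)[OF that] by (simp add: sets.sets_into_space Int_absorb2)
  qed
  show "set_integrable M D (\<lambda>x. h (s x))"
    unfolding set_integrable_def eq by (intro Bochner_Integration.integrable_sum int)
  have "(LINT x:D|M. h (s x)) = (\<Sum>i\<in>I. w *\<^sub>R h i)"
    unfolding set_lebesgue_integral_def eq using int val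
    by (subst Bochner_Integration.integral_sum) auto
  then show "(LINT x:D|M. h (s x)) = w *\<^sub>R (\<Sum>i\<in>I. h i)" by (simp add: scaleR_sum_right)
qed

text \<open>
  \<open>s n\<close> sends a point to the name of its cell in the \<open>n\<close>-th partition. The locale is used for the
  unit cube and for the product of two unit cubes.
\<close>

locale equal_partitions =
  fixes M :: "'a measure" and D :: "'a set"
    and s :: "nat \<Rightarrow> 'a \<Rightarrow> 'i" and I :: "nat \<Rightarrow> 'i set" and w :: "nat \<Rightarrow> real"
  assumes finite_index: "finite (I n)"
    and addr: "x \<in> D \<Longrightarrow> s n x \<in> I n"
    and sets_cell: "i \<in> I n \<Longrightarrow> {x \<in> D. s n x = i} \<in> sets M"
    and emeasure_cell: "i \<in> I n \<Longrightarrow> emeasure M {x \<in> D. s n x = i} = ennreal (w n)"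
    and weight_nonneg: "0 \<le> w n"
begin

lemmas step_integrable = partition_integral(1)[OF finite_index addr sets_cell emeasure_cell weight_nonneg]
lemmas step_integral = partition_integral(2)[OF finite_index addr sets_cell emeasure_cell weight_nonneg]

lemma domain_integrable: "integrable M (indicator D :: 'a \<Rightarrow> real)"
  using step_integrable[of 0 "\<lambda>_. 1 :: real"] by (simp add: set_integrable_def)

text \<open>
  The bound \<open>v\<close> may vary with the cell. This matters for integrands that carry a density of
  mean 1 and of unbounded height: their error is measured by the mean of the bound.
\<close>

lemma step_error:
  fixes h :: "'i \<Rightarrow> 'e::{banach, second_countable_topology}"
  assumes g: "set_integrable M D g"
    and le: "\<And>x. x \<in> D \<Longrightarrow> norm (h (s n x) - g x) \<le> v (s n x)"
  shows "norm (w n *\<^sub>R (\<Sum>i\<in>I n. h i) - (LINT x:D|M. g x)) \<le> w n * (\<Sum>i\<in>I n. v i)"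
proof -
  have "w n *\<^sub>R (\<Sum>i\<in>I n. h i) - (LINT x:D|M. g x) = (LINT x:D|M. h (s n x) - g x)"
    using step_integral[of n h] set_integral_diff(2)[OF step_integrable g] by simp
  also have "norm \<dots> \<le> (LINT x:D|M. v (s n x))"
    unfolding set_lebesgue_integral_def
  proof (rule order_trans[OF integral_norm_bound integral_mono])
    show "integrable M (\<lambda>x. norm (indicator D x *\<^sub>R (h (s n x) - g x)))"
      using set_integral_diff(1)[OF step_integrable g]
      unfolding set_integrable_def by (rule integrable_norm)
    show "integrable M (\<lambda>x. indicator D x *\<^sub>R v (s n x))"
      using step_integrable[of n v] by (simp add: set_integrable_def)
    show "norm (indicator D x *\<^sub>R (h (s n x) - g x)) \<le> indicator D x *\<^sub>R v (s n x)" for x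
      using le by (auto simp: indicator_def)
  qed
  also have "\<dots> = w n * (\<Sum>i\<in>I n. v i)" using step_integral[of n v] by simp
  finally show ?thesis .
qed

text \<open>
  Integrability of the limit need not be known beforehand: step functions are measurable, so their
  limit is, and it is bounded because a step function takes finitely many values.
\<close>

lemma uniform_step_limit:
  fixes h :: "nat \<Rightarrow> 'i \<Rightarrow> 'e::{banach, second_countable_topology}"
  assumes lim: "uniform_limit D (\<lambda>n x. h n (s n x)) g sequentially"
  shows "set_integrable M D g"
    and "(\<lambda>n. w n *\<^sub>R (\<Sum>i\<in>I n. h n i)) \<longlonglongrightarrow> (LINT x:D|M. g x)"
proof -
  have meas: "(\<lambda>x. indicator D x *\<^sub>R g x) \<in> borel_measurable M"
  proof (rule borel_measurable_LIMSEQ_metric)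
    show "(\<lambda>x. indicator D x *\<^sub>R h n (s n x)) \<in> borel_measurable M" for n
      using step_integrable[of n "h n"] unfolding set_integrable_def by (rule borel_measurable_integrable)
    show "(\<lambda>n. indicator D x *\<^sub>R h n (s n x)) \<longlonglongrightarrow> indicator D x *\<^sub>R g x" for x
      using tendsto_uniform_limitI[OF lim] by (cases "x \<in> D") auto
  qed
  obtain n0 where n0: "\<And>x. x \<in> D \<Longrightarrow> dist (h n0 (s n0 x)) (g x) < 1"
    using uniform_limitD[OF lim, of 1] by (auto simp: eventually_sequentially)
  define c where "c = (\<Sum>i\<in>I n0. norm (h n0 i)) + 1"
  have gc: "norm (g x) \<le> c" if "x \<in> D" for x
  proof -
    have "norm (g x) \<le> norm (h n0 (s n0 x)) + 1"
      using n0[OF that] norm_triangle_ineq4[of "h n0 (s n0 x)" "h n0 (s n0 x) - g x"]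
      by (simp add: dist_norm)
    also have "norm (h n0 (s n0 x)) \<le> (\<Sum>i\<in>I n0. norm (h n0 i))"
      by (rule member_le_sum[OF addr[OF that]]) (auto simp: finite_index)
    finally show ?thesis by (simp add: c_def)
  qed
  show int: "set_integrable M D g"
    unfolding set_integrable_def
    by (rule Bochner_Integration.integrable_bound[OF integrable_mult_right[OF domain_integrable, of c] meas])
       (use gc in \<open>auto simp: indicator_def intro!: AE_I2 order_trans[OF _ abs_ge_self]\<close>)
  show "(\<lambda>n. w n *\<^sub>R (\<Sum>i\<in>I n. h n i)) \<longlonglongrightarrow> (LINT x:D|M. g x)"
  proof (rule LIMSEQ_I)
    fix e :: real assume e: "0 < e"
    define L where "L = (LINT x|M. indicator D x :: real)"
    have L: "w n * real (card (I n)) = L" for n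
      using step_integral[of n "\<lambda>_. 1 :: real"] by (simp add: L_def set_lebesgue_integral_def)
    have L0: "0 \<le> L" unfolding L_def by (intro integral_nonneg_AE) auto
    define e' where "e' = e / (L + 1)"
    have e': "0 < e'" "e' * L < e" using e L0 by (auto simp: e'_def field_simps)
    obtain N where N: "\<And>n x. n \<ge> N \<Longrightarrow> x \<in> D \<Longrightarrow> dist (h n (s n x)) (g x) < e'"
      using uniform_limitD[OF lim e'(1)] by (auto simp: eventually_sequentially)
    have "norm (w n *\<^sub>R (\<Sum>i\<in>I n. h n i) - (LINT x:D|M. g x)) < e" if "n \<ge> N" for n
    proof -
      have "norm (w n *\<^sub>R (\<Sum>i\<in>I n. h n i) - (LINT x:D|M. g x)) \<le> w n * (\<Sum>i\<in>I n. e')"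
        using N[OF that] by (intro step_error[OF int]) (simp add: dist_norm less_imp_le)
      also have "\<dots> = e' * L" by (simp add: L[of n, symmetric])
      finally show ?thesis using e' by linarith
    qed
    then show "\<exists>no. \<forall>n\<ge>no. norm (w n *\<^sub>R (\<Sum>i\<in>I n. h n i) - (LINT x:D|M. g x)) < e" by blast
  qed
qed

end

section \<open>Elementary intervals of the unit cube\<close>

context digit_base begin

definition digit_vecs :: "((nat \<Rightarrow> nat)^'s) set" where
  "digit_vecs = {u. \<forall>j. digits (u $ j)}"

definition grid :: "nat \<Rightarrow> ((nat \<Rightarrow> nat)^'s) set" where
  "grid n = {u \<in> digit_vecs. \<forall>j i. n \<le> i \<longrightarrow> (u $ j) i = 0}"

definition vec_trunc :: "nat \<Rightarrow> (nat \<Rightarrow> nat)^'s \<Rightarrow> (nat \<Rightarrow> nat)^'s" where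
  "vec_trunc n u = (\<chi> j. trunc_seq n (u $ j))"

lemma finite_grid: "finite (grid n :: ((nat \<Rightarrow> nat)^'s) set)"
proof -
  let ?F = "{f. \<forall>i. (i \<in> {..<n} \<longrightarrow> f i \<in> {..<b}) \<and> (i \<notin> {..<n} \<longrightarrow> f i = (0::nat))}"
  have "finite ?F" by (intro finite_set_of_finite_funs) auto
  then have "finite (vec_lambda ` (PiE UNIV (\<lambda>_::'s. ?F)))"
    by (intro finite_imageI finite_PiE) auto
  moreover have "(grid n :: ((nat \<Rightarrow> nat)^'s) set) \<subseteq> vec_lambda ` (PiE UNIV (\<lambda>_::'s. ?F))"
  proof
    fix u :: "(nat \<Rightarrow> nat)^'s" assume "u \<in> grid n"
    then have "($) u \<in> PiE UNIV (\<lambda>_::'s. ?F)" by (auto simp: grid_def digit_vecs_def digits_def)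
    then show "u \<in> vec_lambda ` (PiE UNIV (\<lambda>_::'s. ?F))" 
      by (intro image_eqI[where x = "($) u"]) auto
  qed
  ultimately show ?thesis by (rule finite_subset[rotated])
qed

lemma vec_trunc_in_grid: "u \<in> digit_vecs \<Longrightarrow> vec_trunc n u \<in> grid n"
  by (auto simp: grid_def digit_vecs_def vec_trunc_def digits_trunc_seq) (simp add: trunc_seq_def)

lemma vec_trunc_grid: "u \<in> grid n \<Longrightarrow> vec_trunc n u = u"
  by (auto simp: grid_def vec_trunc_def vec_eq_iff trunc_seq_def fun_eq_iff)

lemma unit_cube_iff: "(x :: real^'s) \<in> unit_cube \<longleftrightarrow> (\<forall>j. 0 \<le> x $ j \<and> x $ j \<le> 1)"
  by (auto simp: unit_cube_def mem_box_cart)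

lemma vec_sect_digit_vecs: "x \<in> unit_cube \<Longrightarrow> vec_sect b x \<in> digit_vecs"
  by (auto simp: unit_cube_iff digit_vecs_def vec_sect_def digits_seq_sect)

lemma vec_proj_unit_cube: "u \<in> digit_vecs \<Longrightarrow> vec_proj b u \<in> unit_cube"
  by (auto simp: unit_cube_iff digit_vecs_def vec_proj_def seq_proj_nonneg seq_proj_le_1)

lemma vec_proj_sect: "x \<in> unit_cube \<Longrightarrow> vec_proj b (vec_sect b x) = x"
  by (auto simp: unit_cube_iff vec_eq_iff vec_sect_def vec_proj_def seq_proj_sect)

definition address :: "nat \<Rightarrow> real^'s \<Rightarrow> (nat \<Rightarrow> nat)^'s" where
  "address n x = vec_trunc n (vec_sect b x)"

lemma address_in_grid: "x \<in> unit_cube \<Longrightarrow> address n x \<in> grid n"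
  by (simp add: address_def vec_trunc_in_grid vec_sect_digit_vecs)

lemma sets_address: "{x \<in> unit_cube. address n x = a} \<in> sets (borel :: (real^'s) measure)"
proof -
  let ?S = "\<lambda>j. {y \<in> {0..1}. trunc_seq n (seq_sect b y) = a $ j}"
  have "(\<lambda>x :: real^'s. x $ j) -` ?S j \<inter> space borel \<in> sets borel" for j
    by (intro measurable_sets[OF borel_measurable_continuous_onI measurable_trunc_seq_sect] continuous_intros)
  then have "(\<Inter>j\<in>UNIV. (\<lambda>x :: real^'s. x $ j) -` ?S j \<inter> space borel) \<in> sets borel"
    by (intro sets.finite_INT) auto
  moreover have "{x \<in> unit_cube. address n x = a} = (\<Inter>j\<in>UNIV. (\<lambda>x. x $ j) -` ?S j \<inter> space borel)"
    by (auto simp: unit_cube_iff address_def vec_trunc_def vec_sect_def vec_eq_iff)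
  ultimately show ?thesis by simp
qed

definition cell_volume :: "nat \<Rightarrow> nat \<Rightarrow> real" where
  "cell_volume d n = (1 / real b ^ n) ^ d"

text \<open>
  The cell lies between an open and a closed box with the same edge length $b^{-n}$. Which part of the
  boundary belongs to the cell is thus irrelevant.
\<close>

lemma emeasure_address:
  fixes a :: "(nat \<Rightarrow> nat)^'s"
  assumes a: "a \<in> grid n"
  shows "emeasure lborel {x \<in> unit_cube. address n x = a} = ennreal (cell_volume CARD('s) n)"
proof -
  define d :: "real^'s" where "d = (\<chi> j. 1 / real b ^ n)"
  have dig: "digits (a $ j)" for j using a by (auto simp: grid_def digit_vecs_def)
  have tr: "trunc_seq n (a $ j) = a $ j" for j
    using vec_trunc_grid[OF a] by (metis vec_lambda_beta vec_trunc_def)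
  let ?l = "vec_proj b a" and ?u = "vec_proj b a + d"
  have d: "d \<bullet> i = 1 / real b ^ n" if "i \<in> Basis" for i
    using that by (auto simp: d_def Basis_vec_def inner_axis)
  have le: "?l \<bullet> i \<le> ?u \<bullet> i" if "i \<in> Basis" for i using d[OF that] by (simp add: inner_add_left)
  have vol: "(\<Prod>i\<in>Basis. (?u - ?l) \<bullet> i) = cell_volume CARD('s) n"
    by (simp add: d cell_volume_def)
  have box: "emeasure lborel (box ?l ?u) = ennreal (cell_volume CARD('s) n)"
    using emeasure_lborel_box[OF le] vol by simp
  have cbox: "emeasure lborel (cbox ?l ?u) = ennreal (cell_volume CARD('s) n)"
    using emeasure_lborel_cbox[OF le] vol by simp
  have "box ?l ?u \<subseteq> {x \<in> unit_cube. address n x = a}"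
  proof
    fix x assume "x \<in> box ?l ?u"
    then have x: "seq_proj b (a $ j) < x $ j" "x $ j < seq_proj b (a $ j) + 1 / real b ^ n" for j
      by (auto simp: mem_box_cart vec_proj_def d_def)
    have "seq_proj b (a $ j) + 1 / real b ^ n \<le> 1" for j
    proof -
      let ?t = "\<lambda>i. if i < n then (a $ j) i else b - 1"
      have t: "digits ?t" using dig[of j] b2 by (auto simp: digits_def)
      have "(\<lambda>i. ?t (i + n)) = (\<lambda>i. b - 1)" "(\<lambda>i. (a $ j) (i + n)) = (\<lambda>i. 0)"
        using a by (auto simp: grid_def)
      then have "seq_proj b ?t = seq_proj b (a $ j) + 1 / real b ^ n"
        using seq_proj_split[OF t, of n] seq_proj_split[OF dig, of j n] seq_proj_top
        by (simp add: seq_proj_def)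
      then show ?thesis using seq_proj_le_1[OF t] by simp
    qed
    then have x01: "0 \<le> x $ j" "x $ j \<le> 1" for j
      using x[of j] seq_proj_nonneg[OF dig, of j] by (auto intro: order_trans[OF less_imp_le])
    have "trunc_seq n (seq_sect b (x $ j)) = trunc_seq n (a $ j)" for j
      using x[of j] x01[of j] by (intro trunc_seq_sect_eqI dig) (simp_all add: tr)
    then show "x \<in> {x \<in> unit_cube. address n x = a}"
      using x01 by (simp add: unit_cube_iff address_def vec_trunc_def vec_sect_def vec_eq_iff tr)
  qed
  moreover have "{x \<in> unit_cube. address n x = a} \<subseteq> cbox ?l ?u"
  proof clarify
    fix x :: "real^'s" assume x: "x \<in> unit_cube" and a: "a = address n x"
    have "seq_proj b (a $ j) \<le> x $ j \<and> x $ j \<le> seq_proj b (a $ j) + 1 / real b ^ n" for j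
    proof -
      have x01: "0 \<le> x $ j" "x $ j \<le> 1" using x by (auto simp: unit_cube_iff)
      have "a $ j = trunc_seq n (seq_sect b (x $ j))"
        by (simp add: a address_def vec_trunc_def vec_sect_def)
      then show ?thesis
        using seq_proj_trunc[OF digits_seq_sect[OF x01], of n] by (simp add: seq_proj_sect x01)
    qed
    then show "x \<in> cbox (vec_proj b (address n x)) (vec_proj b (address n x) + d)"
      by (simp add: mem_box_cart a vec_proj_def d_def)
  qed
  ultimately show ?thesis
    using box cbox emeasure_mono[of "box ?l ?u" "{x \<in> unit_cube. address n x = a}" lborel]
      emeasure_mono[of "{x \<in> unit_cube. address n x = a}" "cbox ?l ?u" lborel] sets_address[of n a]
    by simp
qed

lemma cell_volume_pos: "0 < cell_volume d n"
  using b2 by (simp add: cell_volume_def)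

lemma cube_partitions:
  "equal_partitions lborel (unit_cube :: (real^'s) set) address grid (cell_volume CARD('s))"
  by unfold_locales
    (auto simp: finite_grid address_in_grid sets_address emeasure_address cell_volume_pos less_imp_le)

lemma cube_pair_partitions:
  "equal_partitions lborel (unit_cube \<times> unit_cube :: ((real^'s) \<times> (real^'s)) set)
     (\<lambda>n (x, y). (address n x, address n y)) (\<lambda>n. grid n \<times> grid n) (\<lambda>n. (cell_volume CARD('s) n)\<^sup>2)"
proof unfold_locales
  fix i n assume i: "i \<in> (grid n \<times> grid n :: (((nat \<Rightarrow> nat)^'s) \<times> ((nat \<Rightarrow> nat)^'s)) set)"
  have eq: "{x \<in> unit_cube \<times> unit_cube. (case x of (x, y) \<Rightarrow> (address n x, address n y)) = i} =
     {x \<in> unit_cube. address n x = fst i} \<times> {y \<in> unit_cube. address n y = snd i}"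
    by auto
  show "{x \<in> unit_cube \<times> unit_cube. (case x of (x, y) \<Rightarrow> (address n x, address n y)) = i} \<in> sets lborel"
    unfolding eq lborel_prod[symmetric] by (intro pair_measureI) (auto simp: sets_address)
  show "emeasure lborel {x \<in> unit_cube \<times> unit_cube. (case x of (x, y) \<Rightarrow> (address n x, address n y)) = i} =
     ennreal ((cell_volume CARD('s) n)\<^sup>2)"
    unfolding eq lborel_prod[symmetric] using i cell_volume_pos[of "CARD('s)" n]
    by (subst lborel.emeasure_pair_measure_Times)
       (auto simp: sets_address emeasure_address ennreal_mult'[symmetric] power2_eq_square)
qed (auto simp: finite_grid address_in_grid)

text \<open>
  The cells fill the cube, so their number need not be computed from the digits.
\<close>

lemma cell_volume_sum: "cell_volume CARD('s) n * real (card (grid n :: ((nat \<Rightarrow> nat)^'s) set)) = 1"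
proof -
  interpret equal_partitions lborel "unit_cube :: (real^'s) set" address grid "cell_volume CARD('s)"
    by (rule cube_partitions)
  have "(LINT x:(unit_cube :: (real^'s) set)|lborel. 1 :: real) = 1"
    using content_cbox_cart[of 0 "1 :: real^'s"]
    by (simp add: set_lebesgue_integral_def unit_cube_def interval_ne_empty_cart)
  then show ?thesis using step_integral[of n "\<lambda>_. 1 :: real"] by simp
qed

end

section \<open>Walsh characters of digit sequences\<close>

text \<open>
  Distributivity over a box of index vectors; it reduces every character sum to dimension one.
\<close>

lemma sum_vec_prod:
  fixes f :: "'s::finite \<Rightarrow> nat \<Rightarrow> 'a::comm_semiring_1"
  shows "(\<Sum>k | \<forall>j. (k :: nat^'s) $ j < N. \<Prod>j\<in>UNIV. f j (k $ j)) = (\<Prod>j\<in>UNIV. \<Sum>i<N. f j i)"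
proof -
  have "(\<Prod>j\<in>UNIV. \<Sum>i<N. f j i) = (\<Sum>g\<in>PiE UNIV (\<lambda>_. {..<N}). \<Prod>j\<in>UNIV. f j (g j))"
    by (rule prod_sum_PiE) auto
  also have "\<dots> = (\<Sum>k | \<forall>j. (k :: nat^'s) $ j < N. \<Prod>j\<in>UNIV. f j (k $ j))"
    by (rule sum.reindex_bij_witness[of _ "($)" vec_lambda]) auto
  finally show ?thesis by simp
qed

lemma finite_vec_less: "finite {k :: nat^'s. \<forall>j. k $ j < N}"
proof (rule finite_subset)
  show "{k :: nat^'s. \<forall>j. k $ j < N} \<subseteq> vec_lambda ` PiE UNIV (\<lambda>_. {..<N})"
  proof
    fix k :: "nat^'s" assume "k \<in> {k. \<forall>j. k $ j < N}"
    then show "k \<in> vec_lambda ` PiE UNIV (\<lambda>_. {..<N})"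
      by (intro image_eqI[where x = "($) k"]) auto
  qed
qed (auto intro!: finite_imageI finite_PiE)

context digit_base begin

definition omega :: complex where
  "omega = exp (2 * of_real pi * \<i> / of_nat b)"

lemma omega_power_eq_1_iff: "omega ^ t = 1 \<longleftrightarrow> b dvd t"
proof -
  have "omega ^ t = exp (2 * of_real pi * \<i> * of_nat t / of_nat b)"
    unfolding omega_def exp_of_nat_mult[symmetric] by (simp add: mult.commute)
  then show ?thesis using complex_root_unity_eq_1[of b t] b2 by simp
qed

lemma norm_omega: "norm omega = 1"
proof -
  have "2 * of_real pi * \<i> / of_nat b = \<i> * of_real (2 * pi / real b)" by simp
  then show ?thesis unfolding omega_def by (metis norm_exp_i_times)
qed

lemma omega_power_cong:
  assumes "s mod b = t mod b" shows "omega ^ s = omega ^ t"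
proof -
  have "omega ^ s = omega ^ (s mod b)" for s
  proof -
    have "omega ^ s = omega ^ (b * (s div b) + s mod b)" by simp
    also have "\<dots> = omega ^ (s mod b)"
      using omega_power_eq_1_iff[of b] by (simp only: power_add power_mult) simp
    finally show ?thesis .
  qed
  then show ?thesis using assms by metis
qed

lemma omega_geometric: "(\<Sum>l<b. omega ^ (l * t)) = (if b dvd t then of_nat b else 0)"
proof -
  have *: "omega ^ (l * t) = (omega ^ t) ^ l" for l by (metis power_mult mult.commute)
  show ?thesis
  proof (cases "b dvd t")
    case True
    then show ?thesis using omega_power_eq_1_iff[of t] by (simp add: *)
  next
    case False
    then have "omega ^ t \<noteq> 1" by (simp add: omega_power_eq_1_iff)
    moreover have "(omega ^ t) ^ b = 1"
      using omega_power_eq_1_iff[of "t * b"] by (simp add: power_mult)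
    ultimately show ?thesis using False by (simp add: * geometric_sum)
  qed
qed

text \<open>
  Appending a leading digit $l$ to $k$ multiplies the summand by $\omega^{l t_n}$, so the sum is a
  product of $n$ geometric sums. The numbers $t_i$ are arbitrary: they are digit differences in the
  orthogonality relation and column sums of the generating matrices in the sum over a net.
\<close>

lemma omega_digit_sum:
  "(\<Sum>k<b ^ n. omega ^ (\<Sum>i<n. nat_digit b k i * t i)) = (if \<forall>i<n. b dvd t i then of_nat (b ^ n) else 0)"
proof (induction n)
  case (Suc n)
  define S where "S k = (\<Sum>i<n. nat_digit b k i * t i)" for k
  have digit_low: "nat_digit b (k + l * b ^ n) i = nat_digit b k i" if "i < n" for k l i
  proof -
    obtain d where "n = Suc (i + d)" using less_imp_Suc_add[OF \<open>i < n\<close>] by blast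
    then have "l * b ^ n = b ^ i * (b * (l * b ^ d))" by (simp add: power_add)
    moreover have "(k + b ^ i * (b * (l * b ^ d))) div b ^ i = k div b ^ i + b * (l * b ^ d)"
      using b2 by simp
    ultimately have "(k + l * b ^ n) div b ^ i = k div b ^ i + b * (l * b ^ d)"
      by (simp only:)
    then show ?thesis unfolding nat_digit_def by simp
  qed
  have digit_top: "nat_digit b (k + l * b ^ n) n = l" if "k < b ^ n" "l < b" for k l
    using that by (simp add: nat_digit_def)
  have "(\<Sum>k<b ^ Suc n. omega ^ (\<Sum>i<Suc n. nat_digit b k i * t i)) =
      (\<Sum>l<b. \<Sum>k<b ^ n. omega ^ (\<Sum>i<Suc n. nat_digit b (k + l * b ^ n) i * t i))"
  proof -
    let ?g = "\<lambda>k. omega ^ (\<Sum>i<Suc n. nat_digit b k i * t i)"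
    have "sum ?g {l * b ^ n..<l * b ^ n + b ^ n} = (\<Sum>k<b ^ n. ?g (k + l * b ^ n))" for l
      using sum.shift_bounds_nat_ivl[of ?g 0 "l * b ^ n" "b ^ n"]
      by (simp add: atLeast0LessThan add.commute)
    moreover have "(\<Sum>k<b ^ Suc n. ?g k) = (\<Sum>l<b. sum ?g {l * b ^ n..<l * b ^ n + b ^ n})"
      by (simp only: sum.nat_group power_Suc)
    ultimately show ?thesis by (simp only:)
  qed
  also have "\<dots> = (\<Sum>l<b. \<Sum>k<b ^ n. omega ^ (l * t n) * omega ^ S k)"
  proof (intro sum.cong refl)
    fix l k assume lk: "l \<in> {..<b}" "k \<in> {..<b ^ n}"
    have "(\<Sum>i<n. nat_digit b (k + l * b ^ n) i * t i) = S k"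
      unfolding S_def by (intro sum.cong) (simp_all add: digit_low)
    then show "omega ^ (\<Sum>i<Suc n. nat_digit b (k + l * b ^ n) i * t i) = omega ^ (l * t n) * omega ^ S k"
      using lk by (simp add: digit_top power_add mult.commute)
  qed
  also have "\<dots> = (\<Sum>l<b. omega ^ (l * t n)) * (\<Sum>k<b ^ n. omega ^ S k)"
    by (simp add: sum_product)
  also have "\<dots> = (if \<forall>i<Suc n. b dvd t i then of_nat (b ^ Suc n) else 0)"
    using Suc by (auto simp: omega_geometric S_def less_Suc_eq)
  finally show ?case .
qed simp

definition chr :: "nat \<Rightarrow> (nat \<Rightarrow> nat) \<Rightarrow> complex" where
  "chr k u = omega ^ (\<Sum>i\<in>nat_digit_supp b k. nat_digit b k i * u i)"

text \<open>
  The Walsh functions as characters of the group of digit vectors, where they are multiplicative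
  without exception; on real points addition loses the information about non-unique expansions.
\<close>

definition vchr :: "nat^'s \<Rightarrow> (nat \<Rightarrow> nat)^'s \<Rightarrow> complex" where
  "vchr k u = (\<Prod>j\<in>UNIV. chr (k $ j) (u $ j))"

lemma vec_wal_eq_vchr: "vec_wal b k x = vchr k (vec_sect b x)"
  by (simp add: vec_wal_def wal_def vchr_def chr_def vec_sect_def omega_def)

lemma nat_digit_supp_subset: "k < b ^ n \<Longrightarrow> nat_digit_supp b k \<subseteq> {..<n}"
proof
  fix i assume k: "k < b ^ n" and i: "i \<in> nat_digit_supp b k"
  have "i < n"
  proof (rule ccontr)
    assume "\<not> i < n"
    then have "b ^ n \<le> b ^ i" using b2 by (intro power_increasing) auto
    with k i show False by (simp add: nat_digit_supp_def nat_digit_def)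
  qed
  then show "i \<in> {..<n}" by simp
qed

lemma less_base_power: "k < b ^ k"
  using b2 by (metis less_exp order.strict_trans2 power_mono zero_le)

lemma chr_eq: "k < b ^ n \<Longrightarrow> chr k u = omega ^ (\<Sum>i<n. nat_digit b k i * u i)"
  unfolding chr_def
  by (intro arg_cong[where f = "power omega"] sum.mono_neutral_left nat_digit_supp_subset)
     (auto simp: nat_digit_supp_def)

lemma chr_seq_add: "chr k (seq_add b u v) = chr k u * chr k v"
proof -
  have "(\<Sum>i\<in>nat_digit_supp b k. nat_digit b k i * ((u i + v i) mod b)) mod b =
      (\<Sum>i\<in>nat_digit_supp b k. nat_digit b k i * (u i + v i)) mod b"
    by (subst (1 2) mod_sum_eq[symmetric]) (simp add: mod_mult_right_eq)
  then show ?thesis unfolding chr_def seq_add_def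
    by (subst omega_power_cong) (simp_all add: power_add[symmetric] sum.distrib distrib_left)
qed

lemma chr_trunc_seq: "k < b ^ n \<Longrightarrow> chr k (trunc_seq n u) = chr k u"
  by (simp add: chr_eq trunc_seq_def)

lemma vchr_vec_add: "vchr k (vec_add b u v) = vchr k u * vchr k v"
  by (simp add: vchr_def vec_add_def chr_seq_add prod.distrib)

lemma vchr_vec_trunc: "(\<And>j. k $ j < b ^ n) \<Longrightarrow> vchr k (vec_trunc n u) = vchr k u"
  by (simp add: vchr_def vec_trunc_def chr_trunc_seq)

lemma norm_vchr: "norm (vchr k u) = 1"
  by (simp add: vchr_def prod_norm[symmetric] chr_def norm_power norm_omega)

text \<open>
  Multiplication by $b - 1$ is negation modulo $b$, which stays within the natural numbers.
\<close>

lemma digit_diff_dvd_iff: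
  assumes "x < b" "y < b" shows "b dvd x + (b - 1) * y \<longleftrightarrow> x = y"
proof -
  have "int (x + (b - 1) * y) = (int x - int y) + int b * int y"
  proof -
    obtain c where "b = Suc c" using b2 by (cases b) auto
    then show ?thesis by (simp add: algebra_simps)
  qed
  then have "b dvd x + (b - 1) * y \<longleftrightarrow> int b dvd int x - int y"
    by (metis dvd_add_left_iff dvd_triv_left int_dvd_int_iff)
  also have "\<dots> \<longleftrightarrow> x = y"
    using assms by (simp flip: mod_eq_dvd_iff)
  finally show ?thesis .
qed

lemma chr_orthogonal:
  assumes "digits u" "digits v"
  shows "(\<Sum>k<b ^ n. chr k u * cnj (chr k v)) = (if trunc_seq n u = trunc_seq n v then of_nat (b ^ n) else 0)"
proof -
  have cnj_omega: "cnj omega = omega ^ (b - 1)"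
  proof -
    have "omega ^ (b - 1) * omega = 1"
      using b2 omega_power_eq_1_iff[of b] by (simp flip: power_Suc2)
    moreover have "cnj omega * omega = 1"
      using norm_omega by (metis complex_norm_square mult.commute of_real_1 power_one)
    ultimately show ?thesis by (metis mult_cancel_right mult_zero_right zero_neq_one)
  qed
  have "(\<Sum>k<b ^ n. chr k u * cnj (chr k v)) =
      (\<Sum>k<b ^ n. omega ^ (\<Sum>i<n. nat_digit b k i * (u i + (b - 1) * v i)))"
  proof (intro sum.cong refl)
    fix k assume "k \<in> {..<b ^ n}"
    then show "chr k u * cnj (chr k v) = omega ^ (\<Sum>i<n. nat_digit b k i * (u i + (b - 1) * v i))"
      by (simp add: chr_eq cnj_omega power_mult[symmetric] power_add[symmetric] sum.distrib
          sum_distrib_left distrib_left mult.left_commute)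
  qed
  also have "\<dots> = (if \<forall>i<n. b dvd u i + (b - 1) * v i then of_nat (b ^ n) else 0)"
    by (rule omega_digit_sum)
  also have "(\<forall>i<n. b dvd u i + (b - 1) * v i) \<longleftrightarrow> trunc_seq n u = trunc_seq n v"
    using assms by (auto simp: digit_diff_dvd_iff[unfolded One_nat_def] digits_def trunc_seq_def fun_eq_iff)
  finally show ?thesis .
qed

text \<open>
  Summed over all frequencies below $b^n$, the characters form a Dirichlet kernel that is exactly a multiple
  of the indicator of agreement in the first $n$ digits.
\<close>

lemma vchr_orthogonal:
  fixes u v :: "(nat \<Rightarrow> nat)^'s"
  assumes "u \<in> digit_vecs" "v \<in> digit_vecs"
  shows "(\<Sum>k | \<forall>j. k $ j < b ^ n. vchr k u * cnj (vchr k v)) =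
    (if vec_trunc n u = vec_trunc n v then of_nat (b ^ n) ^ CARD('s) else 0)"
proof -
  have "(\<Sum>k | \<forall>j. k $ j < b ^ n. vchr k u * cnj (vchr k v)) =
      (\<Prod>j\<in>UNIV. \<Sum>i<b ^ n. chr i (u $ j) * cnj (chr i (v $ j)))"
    unfolding sum_vec_prod[symmetric] by (simp add: vchr_def prod.distrib)
  also have "\<dots> = (\<Prod>j\<in>UNIV. if trunc_seq n (u $ j) = trunc_seq n (v $ j) then of_nat (b ^ n) else 0)"
    using assms by (simp add: chr_orthogonal digit_vecs_def)
  also have "\<dots> = (if vec_trunc n u = vec_trunc n v then of_nat (b ^ n) ^ CARD('s) else 0)"
    by (auto simp: vec_trunc_def vec_eq_iff intro!: prod_zero)
  finally show ?thesis .
qed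

text \<open>
  The exponent of the character at the $n$-th net point is linear in the digits of $n$, with
  coefficients that all vanish modulo $b$ exactly if $k$ lies in the dual net.
\<close>

lemma sum_vchr_net:
  "(\<Sum>n<b ^ m. vchr k (net_point b m C n)) = (if k \<in> dual_net b m C then of_nat (b ^ m) else 0)"
proof -
  define t where "t r = (\<Sum>j\<in>UNIV. \<Sum>i\<in>nat_digit_supp b (k $ j). nat_digit b (k $ j) i * (C $ j) i r)" for r
  have "vchr k (net_point b m C n) = omega ^ (\<Sum>r<m. nat_digit b n r * t r)" for n
  proof -
    let ?c = "\<lambda>j i. \<Sum>r<m. nat_digit b n r * (C $ j) i r"
    have "vchr k (net_point b m C n) =
        omega ^ (\<Sum>j\<in>UNIV. \<Sum>i\<in>nat_digit_supp b (k $ j). nat_digit b (k $ j) i * (?c j i mod b))"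
      by (simp add: vchr_def chr_def net_point_def power_sum)
    also have "\<dots> = omega ^ (\<Sum>j\<in>UNIV. \<Sum>i\<in>nat_digit_supp b (k $ j). nat_digit b (k $ j) i * ?c j i)"
      unfolding power_sum
      by (intro prod.cong refl omega_power_cong) (simp add: mod_mult_right_eq)
    also have "(\<Sum>j\<in>UNIV. \<Sum>i\<in>nat_digit_supp b (k $ j). nat_digit b (k $ j) i * ?c j i) =
        (\<Sum>j\<in>UNIV. \<Sum>r<m. \<Sum>i\<in>nat_digit_supp b (k $ j). nat_digit b n r * (nat_digit b (k $ j) i * (C $ j) i r))"
      unfolding sum_distrib_left by (subst sum.swap) (simp add: mult.left_commute)
    also have "\<dots> = (\<Sum>r<m. nat_digit b n r * t r)"
      unfolding t_def sum_distrib_left by (rule sum.swap)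
    finally show ?thesis .
  qed
  then show ?thesis using omega_digit_sum[where n = m and t = t]
    by (simp add: dual_net_def t_def dvd_eq_mod_eq_0)
qed

text \<open>
  On a constant digit sequence $l$ the character is $\omega^{l \delta(k)}$, so the sum is a geometric sum in
  each coordinate.
\<close>

lemma sum_vchr_const:
  "(\<Sum>l | \<forall>j. (l :: nat^'s) $ j < b. vchr k (const_vec l)) =
    (if \<forall>j. k $ j \<in> even_digit_sum b then of_nat b ^ CARD('s) else 0)"
proof -
  have "chr i (\<lambda>_. l) = omega ^ (l * digit_sum b i)" for i l
    by (simp add: chr_def digit_sum_def sum_distrib_left mult.commute)
  then have "(\<Sum>l | \<forall>j. (l :: nat^'s) $ j < b. vchr k (const_vec l)) =
      (\<Prod>j\<in>UNIV. \<Sum>l<b. omega ^ (l * digit_sum b (k $ j)))"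
    unfolding sum_vec_prod[symmetric] by (simp add: vchr_def const_vec_def)
  also have "\<dots> = (if \<forall>j. k $ j \<in> even_digit_sum b then of_nat b ^ CARD('s) else 0)"
    using b2 by (auto simp: omega_geometric even_digit_sum_def dvd_eq_mod_eq_0)
  finally show ?thesis .
qed

end

section \<open>Finite functionals on a reproducing kernel Hilbert space\<close>

context rkhs begin

lemma ip_add_right:
  assumes "f \<in> H" "g \<in> H" "h \<in> H"
  shows "ip h (\<lambda>x\<in>D. f x + g x) = ip h f + ip h g"
  using ip_add[OF assms] ip_commute[OF assms(3)] add_mem assms by metis

lemma ip_scale_right:
  assumes "f \<in> H" "h \<in> H"
  shows "ip h (\<lambda>x\<in>D. c * f x) = c * ip h f"
  using ip_scale[OF assms, of c] ip_commute[OF assms(2)] scale_mem assms by metis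

text \<open>
  If \<open>ip g g \<noteq> 0\<close>, subtract from \<open>f\<close> its projection onto \<open>g\<close> and use that the squared norm of the rest is nonnegative.
\<close>

lemma cauchy_schwarz:
  assumes f: "f \<in> H" and g: "g \<in> H"
  shows "\<bar>ip f g\<bar> \<le> sqrt (ip f f) * sqrt (ip g g)"
proof (cases "ip g g = 0")
  case True
  have "g = (\<lambda>x\<in>D. 0)" using ip_definite[OF g True] .
  then have "g = (\<lambda>x\<in>D. 0 * f x)" by (auto simp: restrict_def)
  then have "ip f g = 0" using ip_scale_right[OF f f, of 0] by simp
  then show ?thesis using True by simp
next
  case False
  then have pos: "0 < ip g g" using ip_nonneg[OF g] by simp
  \<comment> \<open>the minimizer of the norm of f + t g\<close>
  define t where "t = - ip f g / ip g g"
  define u where "u = (\<lambda>x\<in>D. t * g x)"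
  have u: "u \<in> H" unfolding u_def by (rule scale_mem[OF g])
  have "0 \<le> ip (\<lambda>x\<in>D. f x + u x) (\<lambda>x\<in>D. f x + u x)" by (intro ip_nonneg add_mem f u)
  also have "\<dots> = ip f f + 2 * ip f u + ip u u"
    using ip_commute[OF u f] by (simp add: ip_add[OF f u] ip_add_right[OF f u] add_mem f u)
  also have "\<dots> = ip f f + 2 * t * ip f g + t * t * ip g g"
    using ip_scale_right[OF g f, of t] ip_scale_right[OF g u, of t] ip_scale[OF g g, of t]
    by (fold u_def) simp
  also have "\<dots> = ip f f - (ip f g)\<^sup>2 / ip g g"
    using pos by (simp add: t_def field_simps power2_eq_square)
  finally have "(ip f g)\<^sup>2 \<le> ip f f * ip g g" using pos by (simp add: field_simps)
  then show ?thesis by (metis real_sqrt_abs real_sqrt_le_mono real_sqrt_mult)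
qed

lemma sum_representer:
  assumes "finite A" "\<And>a. a \<in> A \<Longrightarrow> p a \<in> D"
  shows "\<exists>h\<in>H. (\<forall>f\<in>H. ip f h = (\<Sum>a\<in>A. c a * f (p a)))"
  using assms
proof (induction A rule: finite_induct)
  case empty
  have "ip f (\<lambda>x\<in>D. 0) = 0" if "f \<in> H" for f
    using ip_scale_right[OF zero_mem that, of 0] by (simp add: restrict_def cong: if_cong)
  then show ?case using zero_mem by auto
next
  case (insert a A)
  then obtain h where h: "h \<in> H" "\<And>f. f \<in> H \<Longrightarrow> ip f h = (\<Sum>a\<in>A. c a * f (p a))" by auto
  define k where "k = (\<lambda>x\<in>D. c a * (\<lambda>x\<in>D. K x (p a)) x)"
  have k: "k \<in> H" "\<And>f. f \<in> H \<Longrightarrow> ip f k = c a * f (p a)"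
    unfolding k_def using insert.prems
    by (simp_all only: scale_mem kernel_mem insertI1 ip_scale_right reproducing)
  show ?case
  proof (intro bexI[of _ "\<lambda>x\<in>D. k x + h x"] ballI)
    show "ip f (\<lambda>x\<in>D. k x + h x) = (\<Sum>a\<in>insert a A. c a * f (p a))" if "f \<in> H" for f
      using insert.hyps ip_add_right[OF k(1) h(1) that] h(2)[OF that] k(2)[OF that] by simp
  qed (intro add_mem k h)
qed

text \<open>
  The functional has the form "quadrature rule minus sample mean". Its squared norm is the functional
  applied to its own representer, whose value at a point is in turn the functional applied to the kernel there.
\<close>

lemma difference_representer:
  assumes "finite A" "\<And>a. a \<in> A \<Longrightarrow> p a \<in> D" "finite B" "\<And>i. i \<in> B \<Longrightarrow> q i \<in> D"
  obtains h where "h \<in> H"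
    "\<And>f. f \<in> H \<Longrightarrow> ip f h = (\<Sum>a\<in>A. c a * f (p a)) - (\<Sum>i\<in>B. d i * f (q i))"
    "ip h h = (\<Sum>a\<in>A. c a * ((\<Sum>a'\<in>A. c a' * K (p a') (p a)) - (\<Sum>i\<in>B. d i * K (q i) (p a)))) -
       (\<Sum>j\<in>B. d j * ((\<Sum>a\<in>A. c a * K (p a) (q j)) - (\<Sum>i\<in>B. d i * K (q i) (q j))))"
proof -
  let ?L = "\<lambda>f. (\<Sum>a\<in>A. c a * f (p a)) - (\<Sum>i\<in>B. d i * f (q i))"
  obtain h1 where h1: "h1 \<in> H" "\<And>f. f \<in> H \<Longrightarrow> ip f h1 = (\<Sum>a\<in>A. c a * f (p a))"
    using sum_representer[OF assms(1), of p c] assms(2) by blast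
  obtain h2 where h2: "h2 \<in> H" "\<And>f. f \<in> H \<Longrightarrow> ip f h2 = (\<Sum>i\<in>B. - d i * f (q i))"
    using sum_representer[OF assms(3), of q "\<lambda>i. - d i"] assms(4) by blast
  define h where "h = (\<lambda>x\<in>D. h1 x + h2 x)"
  have h: "h \<in> H" unfolding h_def by (intro add_mem h1 h2)
  have rep: "ip f h = ?L f" if "f \<in> H" for f
    using that h1 h2 by (simp add: h_def ip_add_right sum_negf)
  have val: "h x = (\<Sum>a\<in>A. c a * K (p a) x) - (\<Sum>i\<in>B. d i * K (q i) x)" if "x \<in> D" for x
  proof -
    have "h x = ip (\<lambda>y\<in>D. K y x) h"
      using reproducing[OF h that] ip_commute[OF h kernel_mem[OF that]] by simp
    also have "\<dots> = (\<Sum>a\<in>A. c a * K (p a) x) - (\<Sum>i\<in>B. d i * K (q i) x)"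
      using assms by (simp add: rep[OF kernel_mem[OF that]])
    finally show ?thesis .
  qed
  have "ip h h = (\<Sum>a\<in>A. c a * ((\<Sum>a'\<in>A. c a' * K (p a') (p a)) - (\<Sum>i\<in>B. d i * K (q i) (p a)))) -
       (\<Sum>j\<in>B. d j * ((\<Sum>a\<in>A. c a * K (p a) (q j)) - (\<Sum>i\<in>B. d i * K (q i) (q j))))"
    using assms by (simp add: rep[OF h] val)
  with h rep show thesis by (rule that)
qed

text \<open>
  The case of two point evaluations: the modulus of continuity of all functions in the unit ball is
  controlled by the kernel alone.
\<close>

lemma point_difference_bound:
  assumes f: "f \<in> H" and xy: "x \<in> D" "y \<in> D"
  shows "\<bar>f x - f y\<bar> \<le> sqrt (ip f f) * sqrt (K x x - K y x - (K x y - K y y))"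
proof -
  obtain h where h: "h \<in> H" "\<And>f. f \<in> H \<Longrightarrow> ip f h = f x - f y"
    "ip h h = K x x - K y x - (K x y - K y y)"
    using difference_representer[of "{x}" "\<lambda>a. a" "{y}" "\<lambda>a. a" "\<lambda>_. 1" "\<lambda>_. 1"] xy by auto
  then show ?thesis using cauchy_schwarz[OF f h(1)] f by simp
qed

text \<open>
  The dual norm of the functional represented by \<open>h\<close> is the norm of \<open>h\<close>; perturbing the functional by at
  most \<open>e\<close> on the unit ball perturbs the supremum by at most \<open>e\<close>. It is applied
  to an error functional \<open>L\<close> that involves an integral, with \<open>h\<close> representing its discretization.
\<close>

lemma sup_unit_ball:
  assumes h: "h \<in> H" and L: "\<And>f. f \<in> H \<Longrightarrow> sqrt (ip f f) \<le> 1 \<Longrightarrow> \<bar>L f - ip f h\<bar> \<le> e"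
  shows "\<bar>(SUP f\<in>{f \<in> H. sqrt (ip f f) \<le> 1}. \<bar>L f\<bar>) - sqrt (ip h h)\<bar> \<le> e"
proof -
  let ?B = "{f \<in> H. sqrt (ip f f) \<le> 1}" and ?n = "sqrt (ip h h)"
  have n0: "0 \<le> ?n" using ip_nonneg[OF h] by simp
  have zero: "(\<lambda>x\<in>D. 0) \<in> ?B"
    using zero_mem ip_scale[OF zero_mem zero_mem, of 0] by (simp add: restrict_def cong: if_cong)
  have up: "\<bar>L f\<bar> \<le> ?n + e" if "f \<in> ?B" for f
  proof -
    have "\<bar>ip f h\<bar> \<le> sqrt (ip f f) * ?n" using that h by (intro cauchy_schwarz) auto
    also have "\<dots> \<le> 1 * ?n" using that n0 by (intro mult_right_mono) auto
    finally show ?thesis using L[of f] that by auto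
  qed
  have bdd: "bdd_above ((\<lambda>f. \<bar>L f\<bar>) ` ?B)" using up by (intro bdd_aboveI[of _ "?n + e"]) auto
  have "(SUP f\<in>?B. \<bar>L f\<bar>) \<le> ?n + e"
    using up zero by (intro cSUP_least) auto
  moreover have "?n - e \<le> (SUP f\<in>?B. \<bar>L f\<bar>)"
  proof -
    define r where "r = ?n"
    \<comment> \<open>normalizing h attains the dual norm; for h = 0 this is the zero function, as inverse 0 = 0\<close>
    define g where "g = (\<lambda>x\<in>D. inverse r * h x)"
    have g: "g \<in> H" unfolding g_def by (rule scale_mem[OF h])
    have "ip h h = r * r" using ip_nonneg[OF h] by (simp add: r_def)
    then have gh: "ip g h = inverse r * (r * r)" and gg: "ip g g = inverse r * (inverse r * (r * r))"
      using ip_scale[OF h h, of "inverse r"] ip_scale[OF h g, of "inverse r"]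
        ip_scale_right[OF h h, of "inverse r"] by (simp_all add: g_def)
    have "ip g g \<le> 1" "ip g h = ?n"
      unfolding gh gg r_def[symmetric] by (simp_all add: divide_simps)
    then have "?n - e \<le> \<bar>L g\<bar>" "g \<in> ?B" using L[OF g] g by auto
    then show ?thesis using cSUP_upper[OF _ bdd, of g] by linarith
  qed
  ultimately show ?thesis by linarith
qed

end

section \<open>Digit sequences under addition and truncation\<close>

context digit_base begin

lemma vec_add_in_digit_vecs: "vec_add b u v \<in> digit_vecs"
  using b2 by (auto simp: digit_vecs_def digits_def vec_add_def seq_add_def)

lemma vec_trunc_vec_add: "vec_trunc n (vec_add b u v) = vec_add b (vec_trunc n u) (vec_trunc n v)"
  by (auto simp: vec_trunc_def vec_add_def seq_add_def trunc_seq_def vec_eq_iff)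

lemma vec_add_in_grid: "u \<in> grid n \<Longrightarrow> v \<in> grid n \<Longrightarrow> vec_add b u v \<in> grid n"
  using vec_add_in_digit_vecs[of u v] by (auto simp: grid_def vec_add_def seq_add_def)

lemma vec_add_left_cancel:
  assumes "u \<in> digit_vecs" "v \<in> digit_vecs"
  shows "vec_add b z u = vec_add b z v \<longleftrightarrow> u = v"
proof
  assume eq: "vec_add b z u = vec_add b z v"
  have "(u $ j) i = (v $ j) i" for j i
  proof -
    have "((z $ j) i + (u $ j) i) mod b = ((z $ j) i + (v $ j) i) mod b"
      using eq by (simp add: vec_eq_iff vec_add_def seq_add_def fun_eq_iff)
    then have "(int ((z $ j) i) + int ((u $ j) i)) mod int b = (int ((z $ j) i) + int ((v $ j) i)) mod int b"
      by (metis of_nat_add zmod_int)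
    then have "int ((u $ j) i) mod int b = int ((v $ j) i) mod int b"
      by (simp add: mod_eq_dvd_iff)
    then show ?thesis
      using assms by (simp add: digit_vecs_def digits_def)
  qed
  then show "u = v" by (simp add: vec_eq_iff fun_eq_iff)
qed simp

lemma vec_add_left_commute: "vec_add b u (vec_add b v w) = vec_add b v (vec_add b u w)"
  by (simp add: vec_eq_iff vec_add_def seq_add_def fun_eq_iff mod_simps add.left_commute)

text \<open>
  The finite counterpart of the invariance of the integral over the cube under digital shifts.
\<close>

lemma sum_grid_translate:
  assumes "z \<in> grid n"
  shows "(\<Sum>a\<in>grid n. g (vec_add b z a)) = (\<Sum>a\<in>grid n. g a)"
proof (rule sum.reindex_bij_betw)
  have "inj_on (vec_add b z) (grid n)"
    by (auto simp: inj_on_def vec_add_left_cancel grid_def)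
  then show "bij_betw (vec_add b z) (grid n) (grid n)"
    using endo_inj_surj[OF finite_grid, of "vec_add b z" n] vec_add_in_grid[OF assms]
    by (auto simp: bij_betw_def)
qed

definition close :: "nat \<Rightarrow> real^'s \<Rightarrow> real^'s \<Rightarrow> bool" where
  "close n x y \<longleftrightarrow> (\<forall>j. \<bar>x $ j - y $ j\<bar> \<le> 1 / real b ^ n)"

lemma close_refl: "close n x x"
  by (simp add: close_def)

lemma close_vec_trunc:
  assumes "u \<in> digit_vecs" shows "close n (vec_proj b (vec_trunc n u)) (vec_proj b u)"
  unfolding close_def
proof
  fix j
  have "digits (u $ j)" using assms by (simp add: digit_vecs_def)
  from seq_proj_trunc[OF this, of n]
  show "\<bar>vec_proj b (vec_trunc n u) $ j - vec_proj b u $ j\<bar> \<le> 1 / real b ^ n"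
    by (simp add: vec_proj_def vec_trunc_def)
qed

lemma close_address: "x \<in> unit_cube \<Longrightarrow> close n (vec_proj b (address n x)) x"
  using close_vec_trunc[OF vec_sect_digit_vecs, of x n] by (simp add: address_def vec_proj_sect)

lemma vec_proj_grid: "a \<in> grid n \<Longrightarrow> vec_proj b a \<in> unit_cube"
  by (simp add: grid_def vec_proj_unit_cube)

lemma uniformly_continuous_close:
  fixes K :: "real^'s \<Rightarrow> real^'s \<Rightarrow> real"
  assumes cont: "continuous_on (unit_cube \<times> unit_cube) (\<lambda>(x, y). K x y)" and e: "0 < e"
  obtains N where "\<And>n x x' y y'. n \<ge> N \<Longrightarrow> x \<in> unit_cube \<Longrightarrow> x' \<in> unit_cube \<Longrightarrow>
    y \<in> unit_cube \<Longrightarrow> y' \<in> unit_cube \<Longrightarrow> close n x x' \<Longrightarrow> close n y y' \<Longrightarrow> \<bar>K x y - K x' y'\<bar> < e"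
proof -
  have "compact (unit_cube \<times> unit_cube :: ((real^'s) \<times> (real^'s)) set)"
    by (intro compact_Times) (simp_all add: unit_cube_def)
  then have "uniformly_continuous_on (unit_cube \<times> unit_cube) (\<lambda>(x, y). K x y)"
    using cont by (rule compact_uniformly_continuous[rotated])
  then obtain d where d: "d > 0"
    "\<And>x y x' y'. x \<in> unit_cube \<Longrightarrow> y \<in> unit_cube \<Longrightarrow> x' \<in> unit_cube \<Longrightarrow> y' \<in> unit_cube \<Longrightarrow>
       dist (x', y') (x, y) < d \<Longrightarrow> dist (K x' y') (K x y) < e"
    using e unfolding uniformly_continuous_on_def by (fastforce simp: mem_Times_iff)
  have "(\<lambda>n. 2 * real CARD('s) * (1 / real b) ^ n) \<longlonglongrightarrow> 2 * real CARD('s) * 0"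
    using b2 by (intro tendsto_intros LIMSEQ_power_zero) auto
  then have "\<forall>\<^sub>F n in sequentially. 2 * real CARD('s) * (1 / real b) ^ n < d"
    using d(1) by (intro order_tendstoD) auto
  then obtain N where N: "\<And>n. n \<ge> N \<Longrightarrow> 2 * real CARD('s) * (1 / real b) ^ n < d"
    by (auto simp: eventually_sequentially)
  have "\<bar>K x y - K x' y'\<bar> < e"
    if "n \<ge> N" "x \<in> unit_cube" "x' \<in> unit_cube" "y \<in> unit_cube" "y' \<in> unit_cube"
      "close n x x'" "close n y y'" for n x x' y y'
  proof -
    have dist: "dist u v \<le> real CARD('s) * (1 / real b) ^ n" if "close n u v" for u v :: "real^'s"
    proof -
      have "norm (u - v) \<le> (\<Sum>j\<in>UNIV. \<bar>(u - v) $ j\<bar>)" by (rule norm_le_l1_cart)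
      also have "\<dots> \<le> (\<Sum>j\<in>(UNIV :: 's set). (1 / real b) ^ n)"
        using that by (intro sum_mono) (simp add: close_def power_one_over)
      finally show ?thesis by (simp add: dist_norm)
    qed
    have "dist (x, y) (x', y') \<le> dist x x' + dist y y'"
      unfolding dist_Pair_Pair by (rule sqrt_sum_squares_le_sum) auto
    also have "\<dots> < d" using dist[OF that(6)] dist[OF that(7)] N[OF that(1)] by simp
    finally show ?thesis using d(2)[of x' y' x y] that by (simp add: dist_real_def)
  qed
  then show thesis by (rule that)
qed

end

section \<open>The worst-case error of a shifted point set\<close>

text \<open>
  A finite family of points in the group of digit vectors; a family counts multiplicities in the
  same way as a multiset and is easier to sum over.
\<close>

locale shifted_points = digit_base b + rkhs "unit_cube :: (real^'s) set" H ip K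
  for b :: nat and H :: "(real^'s \<Rightarrow> real) set" and ip K +
  fixes J :: "'j set" and p :: "'j \<Rightarrow> (nat \<Rightarrow> nat)^'s"
  assumes kernel_continuous: "continuous_on (unit_cube \<times> unit_cube) (\<lambda>(x, y). K x y)"
    and finite_J: "finite J" and J_nonempty: "J \<noteq> {}"
    and p_digits: "j \<in> J \<Longrightarrow> p j \<in> digit_vecs"
begin

sublocale cube: equal_partitions lborel "unit_cube :: (real^'s) set" address grid "cell_volume CARD('s)"
  by (rule cube_partitions)

sublocale pair: equal_partitions lborel "unit_cube \<times> unit_cube :: ((real^'s) \<times> (real^'s)) set"
  "\<lambda>n (x, y). (address n x, address n y)" "\<lambda>n. grid n \<times> grid n" "\<lambda>n. (cell_volume CARD('s) n)\<^sup>2"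
  by (rule cube_pair_partitions)

definition weight :: real where "weight = 1 / real (card J)"

lemma weight_sum: "weight * real (card J) = 1" and weight_pos: "0 < weight"
  using finite_J J_nonempty by (simp_all add: weight_def card_gt_0_iff)

definition digit_kernel :: "(nat \<Rightarrow> nat)^'s \<Rightarrow> (nat \<Rightarrow> nat)^'s \<Rightarrow> real" where
  "digit_kernel u v = K (vec_proj b u) (vec_proj b v)"

definition trunc_point :: "nat \<Rightarrow> 'j \<Rightarrow> (nat \<Rightarrow> nat)^'s" where
  "trunc_point n j = vec_trunc n (p j)"

lemma trunc_point_in_grid: "j \<in> J \<Longrightarrow> trunc_point n j \<in> grid n"
  by (simp add: trunc_point_def vec_trunc_in_grid p_digits)

definition shifted_error :: "real^'s \<Rightarrow> real" where
  "shifted_error y = wc_error H ip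
     (image_mset (\<lambda>z. vec_proj b (vec_add b z (vec_sect b y))) (image_mset p (mset_set J)))"

text \<open>
  The squared norm of the error functional at level $n$: the integral is replaced by the grid average,
  and each point $z \oplus \sigma(y)$ by its first $n$ digits, where \<open>a\<close> stands for the first $n$ digits of $y$.
\<close>

definition sq_error :: "nat \<Rightarrow> (nat \<Rightarrow> nat)^'s \<Rightarrow> real" where
  "sq_error n a =
    (\<Sum>u\<in>grid n. cell_volume CARD('s) n * ((\<Sum>u'\<in>grid n. cell_volume CARD('s) n * digit_kernel u' u) -
        (\<Sum>i\<in>J. weight * digit_kernel (vec_add b (trunc_point n i) a) u))) -
    (\<Sum>j\<in>J. weight * ((\<Sum>u\<in>grid n. cell_volume CARD('s) n * digit_kernel u (vec_add b (trunc_point n j) a)) -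
        (\<Sum>i\<in>J. weight * digit_kernel (vec_add b (trunc_point n i) a) (vec_add b (trunc_point n j) a))))"

text \<open>
  The kernel expression in \<open>point_difference_bound\<close> consists of two increments of \<open>K\<close> in its first
  argument, and uniform continuity makes each of them smaller than \<open>e\<^sup>2 / 2\<close>.
\<close>

lemma function_modulus:
  assumes "0 < e"
  obtains N where "\<And>n f x x'. n \<ge> N \<Longrightarrow> f \<in> H \<Longrightarrow> x \<in> unit_cube \<Longrightarrow> x' \<in> unit_cube \<Longrightarrow>
    close n x x' \<Longrightarrow> \<bar>f x - f x'\<bar> \<le> sqrt (ip f f) * e"
proof -
  obtain N where N: "\<And>n x x' y y'. n \<ge> N \<Longrightarrow> x \<in> unit_cube \<Longrightarrow> x' \<in> unit_cube \<Longrightarrow> y \<in> unit_cube \<Longrightarrow>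
     y' \<in> unit_cube \<Longrightarrow> close n x x' \<Longrightarrow> close n y y' \<Longrightarrow> \<bar>K x y - K x' y'\<bar> < e\<^sup>2 / 2"
    using uniformly_continuous_close[OF kernel_continuous, of "e\<^sup>2 / 2"] assms by auto
  have "\<bar>f x - f x'\<bar> \<le> sqrt (ip f f) * e"
    if "n \<ge> N" "f \<in> H" "x \<in> unit_cube" "x' \<in> unit_cube" "close n x x'" for n f x x'
  proof -
    have "K x x - K x' x - (K x x' - K x' x') \<le> e\<^sup>2"
      using N[OF that(1,3,4,3,3,5) close_refl] N[OF that(1,3,4,4,4,5) close_refl] by linarith
    then have "sqrt (K x x - K x' x - (K x x' - K x' x')) \<le> e"
      using assms by (intro real_le_lsqrt) auto
    then have "sqrt (ip f f) * sqrt (K x x - K x' x - (K x x' - K x' x')) \<le> sqrt (ip f f) * e"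
      using ip_nonneg[OF that(2)] by (intro mult_left_mono) auto
    then show ?thesis using point_difference_bound[OF that(2,3,4)] by linarith
  qed
  then show thesis by (rule that)
qed

lemma function_integrable:
  assumes f: "f \<in> H" shows "set_integrable lborel unit_cube f"
proof (rule cube.uniform_step_limit(1)[where h = "\<lambda>n a. f (vec_proj b a)"])
  show "uniform_limit unit_cube (\<lambda>n x. f (vec_proj b (address n x))) f sequentially"
  proof (rule uniform_limitI)
    fix e :: real assume e: "0 < e"
    define r where "r = sqrt (ip f f)"
    have r: "0 \<le> r" using ip_nonneg[OF f] by (simp add: r_def)
    define d where "d = e / (r + 1)"
    have d: "0 < d" "r * d < e" using e r by (auto simp: d_def field_simps)
    obtain N where N: "\<And>n x x'. n \<ge> N \<Longrightarrow> x \<in> unit_cube \<Longrightarrow> x' \<in> unit_cube \<Longrightarrow> close n x x' \<Longrightarrow>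
        \<bar>f x - f x'\<bar> \<le> r * d"
      unfolding r_def using function_modulus[OF d(1)] f by metis
    have "dist (f (vec_proj b (address n x))) (f x) < e" if "n \<ge> N" "x \<in> unit_cube" for n x
      using N[OF that(1) vec_proj_grid[OF address_in_grid[OF that(2)]] that(2) close_address[OF that(2)]] d
      by (simp add: dist_real_def)
    then show "\<forall>\<^sub>F n in sequentially. \<forall>x\<in>unit_cube. dist (f (vec_proj b (address n x))) (f x) < e"
      by (auto simp: eventually_sequentially)
  qed
qed

text \<open>
  On the unit ball the error functional differs from its discretization by the discretization error of
  the integral plus that of the points, and equicontinuity makes both uniformly small.
\<close>

lemma shifted_error_approx:
  assumes e: "0 < e"
  shows "\<exists>N. \<forall>n\<ge>N. \<forall>y\<in>unit_cube. 0 \<le> sq_error n (address n y) \<and>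
      \<bar>shifted_error y - sqrt (sq_error n (address n y))\<bar> \<le> e"
proof -
  obtain N where N: "\<And>n f x x'. n \<ge> N \<Longrightarrow> f \<in> H \<Longrightarrow> x \<in> unit_cube \<Longrightarrow> x' \<in> unit_cube \<Longrightarrow> close n x x' \<Longrightarrow>
     \<bar>f x - f x'\<bar> \<le> sqrt (ip f f) * (e / 2)"
    using function_modulus[of "e / 2"] e half_gt_zero by metis
  have "0 \<le> sq_error n (address n y) \<and> \<bar>shifted_error y - sqrt (sq_error n (address n y))\<bar> \<le> e"
    if n: "n \<ge> N" and y: "y \<in> unit_cube" for n y
  proof -
    define a where "a = address n y"
    define S where "S j = vec_proj b (vec_add b (trunc_point n j) a)" for j
    define T where "T j = vec_proj b (vec_add b (p j) (vec_sect b y))" for j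
    have ST: "S j \<in> unit_cube" "T j \<in> unit_cube" "close n (S j) (T j)" for j
    proof -
      show "S j \<in> unit_cube" "T j \<in> unit_cube"
        by (simp_all add: S_def T_def vec_proj_unit_cube vec_add_in_digit_vecs)
      have "vec_add b (trunc_point n j) a = vec_trunc n (vec_add b (p j) (vec_sect b y))"
        by (simp add: trunc_point_def a_def address_def vec_trunc_vec_add)
      then show "close n (S j) (T j)"
        using close_vec_trunc[OF vec_add_in_digit_vecs] by (simp add: S_def T_def)
    qed
    obtain h where h: "h \<in> H"
      and rep: "\<And>f. f \<in> H \<Longrightarrow> ip f h = (\<Sum>u\<in>grid n. cell_volume CARD('s) n * f (vec_proj b u)) - (\<Sum>j\<in>J. weight * f (S j))"
      and val: "ip h h = sq_error n a"
      unfolding sq_error_def digit_kernel_def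
      by (rule difference_representer[of "grid n" "vec_proj b" J S "\<lambda>_. cell_volume CARD('s) n" "\<lambda>_. weight"])
         (auto simp: finite_grid vec_proj_grid finite_J S_def[abs_def] vec_proj_unit_cube vec_add_in_digit_vecs)
    define L where "L f = (LINT x:unit_cube|lborel. f x) - (\<Sum>j\<in>J. weight * f (T j))" for f
    have "shifted_error y = (SUP f\<in>{f \<in> H. sqrt (ip f f) \<le> 1}. \<bar>L f\<bar>)"
      unfolding shifted_error_def wc_error_def L_def
      by (simp add: T_def weight_def multiset.map_comp comp_def sum_unfold_sum_mset[symmetric]
          sum_divide_distrib)
    moreover have "\<bar>L f - ip f h\<bar> \<le> e" if f: "f \<in> H" and f1: "sqrt (ip f f) \<le> 1" for f
    proof -
      have close_le: "\<bar>f x - f x'\<bar> \<le> e / 2" if "x \<in> unit_cube" "x' \<in> unit_cube" "close n x x'" for x x'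
      proof -
        have "\<bar>f x - f x'\<bar> \<le> sqrt (ip f f) * (e / 2)" by (rule N[OF n f that])
        also have "\<dots> \<le> 1 * (e / 2)" using e f1 by (intro mult_right_mono) auto
        finally show ?thesis by simp
      qed
      have "norm (cell_volume CARD('s) n *\<^sub>R (\<Sum>u\<in>grid n. f (vec_proj b u)) - (LINT x:unit_cube|lborel. f x))
          \<le> cell_volume CARD('s) n * (\<Sum>u\<in>(grid n :: ((nat \<Rightarrow> nat)^'s) set). e / 2)"
      proof (rule cube.step_error[OF function_integrable[OF f]])
        fix x :: "real^'s" assume "x \<in> unit_cube"
        then show "norm (f (vec_proj b (address n x)) - f x) \<le> e / 2"
          unfolding real_norm_def by (intro close_le vec_proj_grid[OF address_in_grid] close_address)
      qed
      also have "\<dots> = e / 2" using cell_volume_sum[where 's = 's, of n] by (simp add: mult.assoc[symmetric])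
      finally have 1: "\<bar>(\<Sum>u\<in>grid n. cell_volume CARD('s) n * f (vec_proj b u)) - (LINT x:unit_cube|lborel. f x)\<bar> \<le> e / 2"
        by (simp add: sum_distrib_left)
      have "\<bar>(\<Sum>j\<in>J. weight * f (S j)) - (\<Sum>j\<in>J. weight * f (T j))\<bar> \<le> (\<Sum>j\<in>J. weight * (e / 2))"
        unfolding sum_subtractf[symmetric] right_diff_distrib[symmetric]
        using weight_pos
        by (intro order_trans[OF sum_abs] sum_mono) (simp only: abs_mult abs_of_pos mult_le_cancel_left_pos close_le[OF ST])
      also have "\<dots> = (weight * real (card J)) * (e / 2)" by simp
      also have "\<dots> = e / 2" by (simp only: weight_sum)
      finally show ?thesis using 1 unfolding L_def rep[OF f] by linarith
    qed
    ultimately show ?thesis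
      using sup_unit_ball[OF h, of L e] ip_nonneg[OF h] by (simp add: val a_def)
  qed
  then show ?thesis by blast
qed

text \<open>
  By \<open>shifted_error_approx\<close> the squared error is a uniform limit of functions of the first $n$ digits of the
  shift.
\<close>

lemma shifted_error_square_limit: "(\<lambda>n. cell_volume CARD('s) n * (\<Sum>a\<in>grid n. sq_error n a)) \<longlonglongrightarrow> (LINT y:unit_cube|lborel. (shifted_error y)\<^sup>2)"
proof -
  \<comment> \<open>nonnegativity is known only for large n, and the square root of a negative number is negative\<close>
  define q where "q n a = max 0 (sq_error n a)" for n a
  have lim: "uniform_limit unit_cube (\<lambda>n y. sqrt (q n (address n y))) shifted_error sequentially"
  proof (rule uniform_limitI)
    fix e :: real assume "0 < e"
    then obtain N where "\<And>n y. n \<ge> N \<Longrightarrow> y \<in> unit_cube \<Longrightarrow> 0 \<le> sq_error n (address n y) \<and>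
      \<bar>shifted_error y - sqrt (sq_error n (address n y))\<bar> \<le> e / 2"
      using shifted_error_approx[of "e / 2"] by auto
    then have "dist (sqrt (q n (address n y))) (shifted_error y) < e" if "n \<ge> N" "y \<in> unit_cube" for n y
      using that \<open>0 < e\<close> by (force simp: dist_real_def q_def abs_minus_commute)
    then show "\<forall>\<^sub>F n in sequentially. \<forall>y\<in>unit_cube. dist (sqrt (q n (address n y))) (shifted_error y) < e"
      by (auto simp: eventually_sequentially)
  qed
  have bdd: "bounded (shifted_error ` unit_cube)"
  proof -
    obtain n where n: "\<And>y. y \<in> unit_cube \<Longrightarrow> dist (sqrt (q n (address n y))) (shifted_error y) < 1"
      using uniform_limitD[OF lim, of 1] by (auto simp: eventually_sequentially)
    have "bounded ((\<lambda>a. sqrt (q n a)) ` grid n)" by (intro finite_imp_bounded finite_imageI finite_grid)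
    then obtain c where c: "\<And>a. a \<in> grid n \<Longrightarrow> \<bar>sqrt (q n a)\<bar> \<le> c" by (auto simp: bounded_real)
    have "\<bar>shifted_error y\<bar> \<le> c + 1" if "y \<in> unit_cube" for y
      using n[OF that] c[OF address_in_grid[OF that]] unfolding dist_real_def by linarith
    then show ?thesis by (auto simp: bounded_real)
  qed
  have "uniform_limit unit_cube (\<lambda>n y. sqrt (q n (address n y)) * sqrt (q n (address n y)))
      (\<lambda>y. shifted_error y * shifted_error y) sequentially"
    by (rule uniform_lim_mult[OF lim lim bdd bdd])
  then have "uniform_limit unit_cube (\<lambda>n y. q n (address n y)) (\<lambda>y. (shifted_error y)\<^sup>2) sequentially"
    by (simp add: q_def power2_eq_square)
  from cube.uniform_step_limit(2)[OF this]
  have "(\<lambda>n. cell_volume CARD('s) n * (\<Sum>a\<in>grid n. q n a)) \<longlonglongrightarrow> (LINT y:unit_cube|lborel. (shifted_error y)\<^sup>2)" by simp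
  moreover have "\<forall>\<^sub>F n in sequentially. cell_volume CARD('s) n * (\<Sum>a\<in>grid n. q n a) = cell_volume CARD('s) n * (\<Sum>a\<in>grid n. sq_error n a)"
  proof -
    obtain N where N: "\<And>n y. n \<ge> N \<Longrightarrow> y \<in> unit_cube \<Longrightarrow> 0 \<le> sq_error n (address n y)"
      using shifted_error_approx[of 1] by auto
    have "q n a = sq_error n a" if "n \<ge> N" "a \<in> grid n" for n a
    proof -
      \<comment> \<open>cells have positive volume, so every grid element is the address of some point\<close>
      have "emeasure lborel {x \<in> unit_cube. address n x = a} \<noteq> 0"
        using cell_volume_pos[of "CARD('s)" n] by (simp add: emeasure_address[OF that(2)])
      then obtain x where "x \<in> unit_cube" "address n x = a" by (metis (mono_tags, lifting) Collect_empty_eq emeasure_empty)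
      then show ?thesis using N[OF that(1), of x] by (simp add: q_def)
    qed
    then show ?thesis by (auto simp: eventually_sequentially intro!: exI[of _ N] sum.cong)
  qed
  ultimately show ?thesis by (rule Lim_transform_eventually)
qed

end

section \<open>Averages of the kernel over digit grids\<close>

lemma sum_rotate: "(\<Sum>a\<in>A. \<Sum>c\<in>C. \<Sum>i\<in>I. f a c i) = (\<Sum>i\<in>I. \<Sum>a\<in>A. \<Sum>c\<in>C. f a c i)"
proof -
  have "(\<Sum>a\<in>A. \<Sum>c\<in>C. \<Sum>i\<in>I. f a c i) = (\<Sum>a\<in>A. \<Sum>i\<in>I. \<Sum>c\<in>C. f a c i)"
    by (intro sum.cong refl sum.swap)
  also have "\<dots> = (\<Sum>i\<in>I. \<Sum>a\<in>A. \<Sum>c\<in>C. f a c i)"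
    by (rule sum.swap)
  finally show ?thesis .
qed

context shifted_points begin

text \<open>
  For the kernel this is the discrete form of the mean over all pairs of points $z, w$ of
  $\int K(z \oplus y, w \oplus y)\,dy$.
\<close>

definition pair_mean :: "nat \<Rightarrow> ((nat \<Rightarrow> nat)^'s \<Rightarrow> (nat \<Rightarrow> nat)^'s \<Rightarrow> real) \<Rightarrow> real" where
  "pair_mean n F = weight\<^sup>2 * (\<Sum>i\<in>J. \<Sum>j\<in>J. cell_volume CARD('s) n *
     (\<Sum>a\<in>grid n. F (vec_add b (trunc_point n i) a) (vec_add b (trunc_point n j) a)))"

definition grid_mean :: "nat \<Rightarrow> ((nat \<Rightarrow> nat)^'s \<Rightarrow> (nat \<Rightarrow> nat)^'s \<Rightarrow> real) \<Rightarrow> real" where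
  "grid_mean n F = (cell_volume CARD('s) n)\<^sup>2 * (\<Sum>a\<in>grid n. \<Sum>c\<in>grid n. F a c)"

text \<open>
  Averaged over the shift, each of the two mixed terms of the quadratic expression equals the
  double average of the kernel, because translations permute the grid. One of them cancels the
  leading term, the other one remains with a negative sign.
\<close>

lemma sq_error_sum:
  "cell_volume CARD('s) n * (\<Sum>a\<in>grid n. sq_error n a) = pair_mean n digit_kernel - grid_mean n digit_kernel"
proof -
  define v where "v = cell_volume CARD('s) n"
  have v1: "v * real (card (grid n :: ((nat \<Rightarrow> nat)^'s) set)) = 1"
    unfolding v_def by (rule cell_volume_sum)
  let ?k = digit_kernel
  define A where "A = (\<Sum>u\<in>grid n. \<Sum>u'\<in>grid n. ?k u' u)"
  define X where "X a = (\<Sum>u\<in>grid n. \<Sum>i\<in>J. ?k (vec_add b (trunc_point n i) a) u)" for a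
  define Y where "Y a = (\<Sum>j\<in>J. \<Sum>u\<in>grid n. ?k u (vec_add b (trunc_point n j) a))" for a
  define Z where "Z a = (\<Sum>j\<in>J. \<Sum>i\<in>J. ?k (vec_add b (trunc_point n i) a) (vec_add b (trunc_point n j) a))" for a
  have q: "sq_error n a = v\<^sup>2 * A - v * weight * X a - weight * v * Y a + weight\<^sup>2 * Z a" for a
    unfolding sq_error_def A_def X_def Y_def Z_def v_def[symmetric]
    by (simp add: right_diff_distrib sum_subtractf sum_distrib_left power2_eq_square mult.assoc)
  have swap: "A = (\<Sum>a\<in>grid n. \<Sum>c\<in>grid n. ?k a c)" unfolding A_def by (rule sum.swap)
  have trans1: "(\<Sum>a\<in>grid n. ?k (vec_add b (trunc_point n i) a) u) = (\<Sum>a\<in>grid n. ?k a u)"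
    and trans2: "(\<Sum>a\<in>grid n. ?k u (vec_add b (trunc_point n i) a)) = (\<Sum>a\<in>grid n. ?k u a)"
    if "i \<in> J" for i u
    by (rule sum_grid_translate[OF trunc_point_in_grid[OF that]])+
  have X: "(\<Sum>a\<in>grid n. X a) = real (card J) * A"
  proof -
    have "(\<Sum>a\<in>grid n. X a) = (\<Sum>u\<in>grid n. \<Sum>i\<in>J. \<Sum>a\<in>grid n. ?k (vec_add b (trunc_point n i) a) u)"
      unfolding X_def by (subst sum.swap) (intro sum.cong refl sum.swap)
    also have "\<dots> = (\<Sum>u\<in>grid n. \<Sum>i\<in>J. \<Sum>a\<in>grid n. ?k a u)"
      by (simp add: trans1)
    finally show ?thesis by (simp add: A_def sum_distrib_left)
  qed
  have Y: "(\<Sum>a\<in>grid n. Y a) = real (card J) * A"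
  proof -
    have "(\<Sum>a\<in>grid n. Y a) = (\<Sum>j\<in>J. \<Sum>u\<in>grid n. \<Sum>a\<in>grid n. ?k u (vec_add b (trunc_point n j) a))"
      unfolding Y_def by (subst sum.swap) (intro sum.cong refl sum.swap)
    also have "\<dots> = (\<Sum>j\<in>J. \<Sum>u\<in>grid n. \<Sum>a\<in>grid n. ?k u a)"
      by (simp add: trans2)
    finally show ?thesis by (simp add: swap)
  qed
  have Z: "weight\<^sup>2 * (v * (\<Sum>a\<in>grid n. Z a)) = pair_mean n ?k"
  proof -
    have "(\<Sum>a\<in>grid n. Z a) = (\<Sum>j\<in>J. \<Sum>i\<in>J. \<Sum>a\<in>grid n. ?k (vec_add b (trunc_point n i) a) (vec_add b (trunc_point n j) a))"
      unfolding Z_def by (subst sum.swap) (intro sum.cong refl sum.swap)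
    also have "\<dots> = (\<Sum>i\<in>J. \<Sum>j\<in>J. \<Sum>a\<in>grid n. ?k (vec_add b (trunc_point n i) a) (vec_add b (trunc_point n j) a))"
      by (rule sum.swap)
    finally show ?thesis by (simp add: pair_mean_def v_def sum_distrib_left)
  qed
  have "v * (\<Sum>a\<in>grid n. sq_error n a) =
      v * (real (card (grid n :: ((nat \<Rightarrow> nat)^'s) set)) * (v\<^sup>2 * A)) - v * (v * weight * (\<Sum>a\<in>grid n. X a))
        - v * (weight * v * (\<Sum>a\<in>grid n. Y a)) + v * (weight\<^sup>2 * (\<Sum>a\<in>grid n. Z a))"
    unfolding q sum.distrib sum_subtractf sum_distrib_left[symmetric] sum_constant
    by (simp add: algebra_simps)
  also have "\<dots> = (v * real (card (grid n :: ((nat \<Rightarrow> nat)^'s) set))) * v\<^sup>2 * A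
        - 2 * (weight * real (card J)) * v\<^sup>2 * A + pair_mean n ?k"
    unfolding X Y Z[symmetric] by (simp add: power2_eq_square)
  also have "\<dots> = pair_mean n ?k - v\<^sup>2 * A" unfolding v1 weight_sum by simp
  finally show ?thesis by (simp add: v_def grid_mean_def swap)
qed

definition mean_char :: "nat^'s \<Rightarrow> complex" where
  "mean_char k = of_real weight * (\<Sum>j\<in>J. vchr k (p j))"

text \<open>
  The density, with respect to the uniform distribution on pairs of grid points, of the random pair
  $(z \oplus u, w \oplus u)$ where $z$ and $w$ are chosen from the points and $u$ from the grid. The condition
  $z \oplus c = w \oplus a$ says that $a$ and $c$ arise from the same $u$.
\<close>

definition pair_density :: "nat \<Rightarrow> (nat \<Rightarrow> nat)^'s \<Rightarrow> (nat \<Rightarrow> nat)^'s \<Rightarrow> real" where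
  "pair_density n a c = weight\<^sup>2 * (\<Sum>i\<in>J. \<Sum>j\<in>J.
     if vec_add b (trunc_point n i) c = vec_add b (trunc_point n j) a then 1 / cell_volume CARD('s) n else 0)"

lemma pair_density_nonneg: "0 \<le> pair_density n a c"
  unfolding pair_density_def using cell_volume_pos[of "CARD('s)" n]
  by (intro mult_nonneg_nonneg sum_nonneg) auto

text \<open>
  Substitute $a = z \oplus u$ and $c = w \oplus v$; since the group is commutative and cancellative, the
  condition in the density becomes $u = v$.
\<close>

lemma grid_mean_density: "grid_mean n (\<lambda>a c. F a c * pair_density n a c) = pair_mean n F"
proof -
  define v where "v = cell_volume CARD('s) n"
  have v0: "v \<noteq> 0" using cell_volume_pos[of "CARD('s)" n] by (simp add: v_def)
  have key: "(\<Sum>a\<in>grid n. \<Sum>c\<in>grid n. F a c * (if vec_add b (trunc_point n i) c = vec_add b (trunc_point n j) a then 1 / v else 0))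
      = (1 / v) * (\<Sum>u\<in>grid n. F (vec_add b (trunc_point n i) u) (vec_add b (trunc_point n j) u))" (is "?l = _")
    if i: "i \<in> J" and j: "j \<in> J" for i j
  proof -
    have eq: "vec_add b (trunc_point n i) (vec_add b (trunc_point n j) w) = vec_add b (trunc_point n j) (vec_add b (trunc_point n i) u) \<longleftrightarrow> w = u"
      if "w \<in> grid n" "u \<in> grid n" for u w
      using that by (subst vec_add_left_commute) (simp add: vec_add_left_cancel vec_add_in_digit_vecs grid_def)
    have "?l = (\<Sum>u\<in>grid n. \<Sum>w\<in>grid n. F (vec_add b (trunc_point n i) u) (vec_add b (trunc_point n j) w) *
        (if vec_add b (trunc_point n i) (vec_add b (trunc_point n j) w) = vec_add b (trunc_point n j) (vec_add b (trunc_point n i) u)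
         then 1 / v else 0))"
      by (subst sum_grid_translate[OF trunc_point_in_grid[OF i], symmetric],
          subst sum_grid_translate[OF trunc_point_in_grid[OF j], symmetric]) simp
    also have "\<dots> = (\<Sum>u\<in>grid n. \<Sum>w\<in>grid n.
        if w = u then F (vec_add b (trunc_point n i) u) (vec_add b (trunc_point n j) u) / v else 0)"
      by (intro sum.cong refl) (auto simp: eq)
    also have "\<dots> = (1 / v) * (\<Sum>u\<in>grid n. F (vec_add b (trunc_point n i) u) (vec_add b (trunc_point n j) u))"
      by (simp add: finite_grid sum_distrib_left)
    finally show ?thesis .
  qed
  have "grid_mean n (\<lambda>a c. F a c * pair_density n a c) = v\<^sup>2 * (weight\<^sup>2 * (\<Sum>a\<in>grid n. \<Sum>c\<in>grid n. \<Sum>i\<in>J. \<Sum>j\<in>J.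
      F a c * (if vec_add b (trunc_point n i) c = vec_add b (trunc_point n j) a then 1 / v else 0)))"
    unfolding grid_mean_def pair_density_def v_def[symmetric]
    by (simp add: sum_distrib_left mult.left_commute)
  also have "(\<Sum>a\<in>grid n. \<Sum>c\<in>grid n. \<Sum>i\<in>J. \<Sum>j\<in>J.
      F a c * (if vec_add b (trunc_point n i) c = vec_add b (trunc_point n j) a then 1 / v else 0)) =
     (\<Sum>i\<in>J. \<Sum>j\<in>J. \<Sum>a\<in>grid n. \<Sum>c\<in>grid n.
      F a c * (if vec_add b (trunc_point n i) c = vec_add b (trunc_point n j) a then 1 / v else 0))"
    by (subst sum_rotate, intro sum.cong refl, rule sum_rotate)
  also have "\<dots> = (\<Sum>i\<in>J. \<Sum>j\<in>J. (1 / v) * (\<Sum>u\<in>grid n. F (vec_add b (trunc_point n i) u) (vec_add b (trunc_point n j) u)))"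
    by (simp add: key)
  finally show ?thesis
    using v0 by (simp add: pair_mean_def v_def[symmetric] sum_distrib_left power2_eq_square mult_ac)
qed

lemma pair_mean_1: "pair_mean n (\<lambda>_ _. 1) = 1"
proof -
  have "pair_mean n (\<lambda>_ _. 1) = (weight * real (card J))\<^sup>2"
    using cell_volume_sum[where 's = 's, of n] by (simp add: pair_mean_def power2_eq_square)
  then show ?thesis by (simp add: weight_sum)
qed

text \<open>
  The squared modulus of a mean over points is a mean over pairs of points, and the characters combine to
  the orthogonality relation for $z \oplus c$ and $w \oplus a$.
\<close>

lemma density_expansion:
  assumes "a \<in> grid n" "c \<in> grid n"
  shows "(\<Sum>k | \<forall>j. k $ j < b ^ n. of_real ((norm (mean_char k))\<^sup>2) * (cnj (vchr k a) * vchr k c)) =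
    of_real (pair_density n a c)"
proof -
  have eq: "of_real ((norm (mean_char k))\<^sup>2) * (cnj (vchr k a) * vchr k c) =
     of_real (weight\<^sup>2) * (\<Sum>i\<in>J. \<Sum>j\<in>J. vchr k (vec_add b (p i) c) * cnj (vchr k (vec_add b (p j) a)))" for k
  proof -
    have "(\<Sum>i\<in>J. \<Sum>j\<in>J. vchr k (vec_add b (p i) c) * cnj (vchr k (vec_add b (p j) a))) =
        (\<Sum>i\<in>J. vchr k (p i) * vchr k c) * (\<Sum>j\<in>J. cnj (vchr k (p j)) * cnj (vchr k a))"
      by (simp add: sum_product vchr_vec_add)
    also have "\<dots> = ((\<Sum>j\<in>J. vchr k (p j)) * vchr k c) * (cnj (\<Sum>j\<in>J. vchr k (p j)) * cnj (vchr k a))"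
      by (simp add: sum_distrib_right)
    finally show ?thesis
      unfolding complex_norm_square mean_char_def by (simp add: power2_eq_square)
  qed
  have "(\<Sum>k | \<forall>j. k $ j < b ^ n. of_real ((norm (mean_char k))\<^sup>2) * (cnj (vchr k a) * vchr k c)) =
     of_real (weight\<^sup>2) * (\<Sum>i\<in>J. \<Sum>j\<in>J. \<Sum>k | \<forall>j. k $ j < b ^ n.
        vchr k (vec_add b (p i) c) * cnj (vchr k (vec_add b (p j) a)))"
    unfolding eq
    by (subst sum_distrib_left[symmetric]) (rule arg_cong[OF sum_rotate[symmetric]])
  also have "\<dots> = of_real (weight\<^sup>2) * (\<Sum>i\<in>J. \<Sum>j\<in>J. 
     if vec_add b (trunc_point n i) c = vec_add b (trunc_point n j) a then of_nat (b ^ n) ^ CARD('s) else 0)"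
    using assms by (simp add: vchr_orthogonal vec_add_in_digit_vecs vec_trunc_vec_add vec_trunc_grid trunc_point_def)
  also have "\<dots> = of_real (pair_density n a c)"
    by (simp add: pair_density_def cell_volume_def power_one_over if_distrib cong: if_cong)
  finally show ?thesis .
qed

end

section \<open>Partial sums of the Walsh series\<close>

context shifted_points begin

definition walsh_integrand :: "nat^'s \<Rightarrow> (real^'s) \<times> (real^'s) \<Rightarrow> complex" where
  "walsh_integrand k z = of_real (K (fst z) (snd z)) * cnj (vec_wal b k (fst z)) * vec_wal b k (snd z)"

definition walsh_step :: "nat^'s \<Rightarrow> ((nat \<Rightarrow> nat)^'s) \<times> ((nat \<Rightarrow> nat)^'s) \<Rightarrow> complex" where
  "walsh_step k z = of_real (digit_kernel (fst z) (snd z)) * cnj (vchr k (fst z)) * vchr k (snd z)"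

lemma vec_wal_address: "(\<And>j. k $ j < b ^ n) \<Longrightarrow> vec_wal b k x = vchr k (address n x)"
  by (simp add: vec_wal_eq_vchr address_def vchr_vec_trunc)

lemma kernel_modulus:
  assumes "0 < e"
  obtains N where "\<And>n x y. n \<ge> N \<Longrightarrow> x \<in> unit_cube \<Longrightarrow> y \<in> unit_cube \<Longrightarrow>
    \<bar>digit_kernel (address n x) (address n y) - K x y\<bar> < e"
proof -
  obtain N where N: "\<And>n x x' y y'. n \<ge> N \<Longrightarrow> x \<in> unit_cube \<Longrightarrow> x' \<in> unit_cube \<Longrightarrow>
    y \<in> unit_cube \<Longrightarrow> y' \<in> unit_cube \<Longrightarrow> close n x x' \<Longrightarrow> close n y y' \<Longrightarrow> \<bar>K x y - K x' y'\<bar> < e"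
    using uniformly_continuous_close[OF kernel_continuous assms] by blast
  show thesis
  proof (rule that)
    fix n and x y :: "real^'s" assume *: "N \<le> n" "x \<in> unit_cube" "y \<in> unit_cube"
    show "\<bar>digit_kernel (address n x) (address n y) - K x y\<bar> < e"
      unfolding digit_kernel_def 
      by (intro N[of n] vec_proj_grid[OF address_in_grid] close_address[OF *(2)] close_address[OF *(3)] *)
  qed
qed

lemma ex_less_base_power: "\<exists>n0. \<forall>n\<ge>n0. \<forall>j. (k :: nat^'s) $ j < b ^ n"
proof -
  define m where "m = Max (range (($) k))"
  have "k $ j < b ^ n" if "n \<ge> m" for n j
  proof -
    have "k $ j \<le> m" unfolding m_def by (intro Max_ge) auto
    also have "m \<le> n" by fact
    also have "n < b ^ n" by (rule less_base_power)
    finally show ?thesis .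
  qed
  then show ?thesis by blast
qed

text \<open>
  Once $n$ exceeds the length of the expansion of $k$, the Walsh functions are exactly functions of the first
  $n$ digits, so only the kernel contributes to the difference.
\<close>

lemma walsh_uniform_limit:
  "uniform_limit (unit_cube \<times> unit_cube)
     (\<lambda>n z. walsh_step k (case z of (x, y) \<Rightarrow> (address n x, address n y))) (walsh_integrand k) sequentially"
proof (rule uniform_limitI)
  fix e :: real assume e: "0 < e"
  obtain N where N: "\<And>n x y. n \<ge> N \<Longrightarrow> x \<in> unit_cube \<Longrightarrow> y \<in> unit_cube \<Longrightarrow>
    \<bar>digit_kernel (address n x) (address n y) - K x y\<bar> < e"
    using kernel_modulus[OF e] by blast
  obtain n0 where n0: "\<And>n j. n \<ge> n0 \<Longrightarrow> k $ j < b ^ n" using ex_less_base_power by blast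
  have "dist (walsh_step k (address n x, address n y)) (walsh_integrand k (x, y)) < e"
    if "n \<ge> max N n0" "x \<in> unit_cube" "y \<in> unit_cube" for n x y
  proof -
    have kn: "k $ j < b ^ n" for j using n0 that by simp
    have "walsh_step k (address n x, address n y) - walsh_integrand k (x, y) =
       of_real (digit_kernel (address n x) (address n y) - K x y) *
         (cnj (vchr k (address n x)) * vchr k (address n y))"
      by (simp add: walsh_step_def walsh_integrand_def vec_wal_address[OF kn] left_diff_distrib)
    then have "norm (walsh_step k (address n x, address n y) - walsh_integrand k (x, y)) =
        \<bar>digit_kernel (address n x) (address n y) - K x y\<bar>"
      by (simp only: norm_mult complex_mod_cnj norm_vchr norm_of_real) simp
    then show ?thesis using N[of n x y] that by (simp add: dist_norm)
  qed
  then show "\<forall>\<^sub>F n in sequentially. \<forall>z\<in>unit_cube \<times> unit_cube.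
      dist (walsh_step k (case z of (x, y) \<Rightarrow> (address n x, address n y))) (walsh_integrand k z) < e"
    by (intro eventually_sequentiallyI[of "max N n0"]) auto
qed

lemmas walsh_integrable = pair.uniform_step_limit(1)[OF walsh_uniform_limit]

lemma walsh_coeff_eq: "walsh_coeff b K k k = (LINT z:unit_cube \<times> unit_cube|lborel. walsh_integrand k z)"
  by (simp add: walsh_coeff_def walsh_integrand_def)

lemma grid_mean_limit: "(\<lambda>n. complex_of_real (grid_mean n digit_kernel)) \<longlonglongrightarrow> walsh_coeff b K 0 0"
proof -
  have "vchr 0 u = 1" for u :: "(nat \<Rightarrow> nat)^'s"
    by (simp add: vchr_def chr_def nat_digit_supp_def nat_digit_def)
  then have "((cell_volume CARD('s) n)\<^sup>2) *\<^sub>R (\<Sum>z\<in>grid n \<times> grid n. walsh_step 0 z) =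
      complex_of_real (grid_mean n digit_kernel)" for n
    by (simp add: walsh_step_def grid_mean_def sum.cartesian_product case_prod_unfold scaleR_conv_of_real)
  then show ?thesis using pair.uniform_step_limit(2)[OF walsh_uniform_limit[of 0]]
    by (simp add: walsh_coeff_eq)
qed

text \<open>
  The density expansion under the integral sign. The sum is collapsed before the
  kernel is discretized, since the number of its terms grows with $n$.
\<close>

lemma walsh_partial_sum:
  "(\<Sum>k | \<forall>j. k $ j < b ^ n. walsh_coeff b K k k * of_real ((norm (mean_char k))\<^sup>2)) =
     (LINT z:unit_cube \<times> unit_cube|lborel.
        complex_of_real (K (fst z) (snd z) * pair_density n (address n (fst z)) (address n (snd z))))" (is ?eq)
  and walsh_partial_sum_integrable: "set_integrable lborel (unit_cube \<times> unit_cube)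
     (\<lambda>z. complex_of_real (K (fst z) (snd z) * pair_density n (address n (fst z)) (address n (snd z))))" (is ?int)
proof -
  let ?B = "{k :: nat^'s. \<forall>j. k $ j < b ^ n}" and ?D = "unit_cube \<times> unit_cube :: ((real^'s) \<times> (real^'s)) set"
  let ?c = "\<lambda>k. complex_of_real ((norm (mean_char k))\<^sup>2)"
  have eq: "indicator ?D z *\<^sub>R complex_of_real (K (fst z) (snd z) * pair_density n (address n (fst z)) (address n (snd z))) =
    (\<Sum>k\<in>?B. (indicator ?D z *\<^sub>R walsh_integrand k z) * ?c k)" for z
  proof (cases "z \<in> ?D")
    case True
    then have g: "address n (fst z) \<in> grid n" "address n (snd z) \<in> grid n" by (auto simp: address_in_grid)
    have "(\<Sum>k\<in>?B. walsh_integrand k z * ?c k) = of_real (K (fst z) (snd z)) *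
       (\<Sum>k\<in>?B. ?c k * (cnj (vchr k (address n (fst z))) * vchr k (address n (snd z))))"
      unfolding sum_distrib_left
      by (intro sum.cong refl) (simp add: walsh_integrand_def vec_wal_address[of _ n] mult_ac)
    also have "\<dots> = of_real (K (fst z) (snd z)) * of_real (pair_density n (address n (fst z)) (address n (snd z)))"
      by (simp only: density_expansion[OF g])
    finally show ?thesis using True by simp
  qed simp
  have int: "integrable lborel (\<lambda>z. (indicator ?D z *\<^sub>R walsh_integrand k z) * ?c k)" for k
    using walsh_integrable[of k] unfolding set_integrable_def by (rule integrable_mult_left)
  show ?int unfolding set_integrable_def eq by (intro Bochner_Integration.integrable_sum int)
  have "(LINT z|lborel. (indicator ?D z *\<^sub>R walsh_integrand k z) * ?c k) = walsh_coeff b K k k * ?c k" for k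
    unfolding walsh_coeff_eq set_lebesgue_integral_def by (rule integral_mult_left_zero)
  then show ?eq
    unfolding set_lebesgue_integral_def eq by (simp only: Bochner_Integration.integral_sum[OF int])
qed

text \<open>
  The density has mean 1, so replacing the kernel by its step approximation costs at most the uniform
  error \<open>e\<close>, however high the density is.
\<close>

lemma pair_mean_approx:
  assumes "0 < e"
  obtains N where "\<And>n. n \<ge> N \<Longrightarrow> norm (complex_of_real (pair_mean n digit_kernel) -
    (\<Sum>k | \<forall>j. k $ j < b ^ n. walsh_coeff b K k k * of_real ((norm (mean_char k))\<^sup>2))) \<le> e"
proof -
  obtain N where N: "\<And>n x y. n \<ge> N \<Longrightarrow> x \<in> unit_cube \<Longrightarrow> y \<in> unit_cube \<Longrightarrow>
    \<bar>digit_kernel (address n x) (address n y) - K x y\<bar> < e"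
    using kernel_modulus[OF assms] by blast
  show thesis
  proof (rule that)
    fix n assume n: "n \<ge> N"
    let ?h = "\<lambda>(a, c). complex_of_real (digit_kernel a c * pair_density n a c)"
    let ?v = "\<lambda>(a, c). e * pair_density n a c"
    have "norm ((cell_volume CARD('s) n)\<^sup>2 *\<^sub>R (\<Sum>z\<in>grid n \<times> grid n. ?h z) -
        (LINT z:unit_cube \<times> unit_cube|lborel.
          complex_of_real (K (fst z) (snd z) * pair_density n (address n (fst z)) (address n (snd z)))))
      \<le> (cell_volume CARD('s) n)\<^sup>2 * (\<Sum>z\<in>grid n \<times> grid n. ?v z)"
    proof (rule pair.step_error[OF walsh_partial_sum_integrable])
      fix z :: "(real^'s) \<times> (real^'s)" assume "z \<in> unit_cube \<times> unit_cube"
      then obtain x y where z: "z = (x, y)" "x \<in> unit_cube" "y \<in> unit_cube" by auto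
      let ?w = "pair_density n (address n x) (address n y)"
      have "norm (complex_of_real (digit_kernel (address n x) (address n y) * ?w) - complex_of_real (K x y * ?w)) =
          \<bar>digit_kernel (address n x) (address n y) - K x y\<bar> * ?w"
        unfolding of_real_diff[symmetric] norm_of_real left_diff_distrib[symmetric] abs_mult
        by (simp add: pair_density_nonneg)
      also have "\<dots> \<le> e * ?w"
        using N[OF n z(2,3)] by (intro mult_right_mono pair_density_nonneg) simp
      finally show "norm (?h (case z of (x, y) \<Rightarrow> (address n x, address n y)) -
          complex_of_real (K (fst z) (snd z) * pair_density n (address n (fst z)) (address n (snd z))))
         \<le> ?v (case z of (x, y) \<Rightarrow> (address n x, address n y))"
        by (simp add: z(1))
    qed
    also have "(cell_volume CARD('s) n)\<^sup>2 * (\<Sum>z\<in>grid n \<times> grid n. ?v z) = e * grid_mean n (\<lambda>a c. 1 * pair_density n a c)"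
      by (simp add: grid_mean_def sum.cartesian_product case_prod_unfold sum_distrib_left mult_ac)
    also have "\<dots> = e" unfolding grid_mean_density pair_mean_1 by simp
    also have "(cell_volume CARD('s) n)\<^sup>2 *\<^sub>R (\<Sum>z\<in>grid n \<times> grid n. ?h z) =
        complex_of_real (grid_mean n (\<lambda>a c. digit_kernel a c * pair_density n a c))"
      by (simp add: grid_mean_def sum.cartesian_product case_prod_unfold scaleR_conv_of_real)
    finally show "norm (complex_of_real (pair_mean n digit_kernel) -
      (\<Sum>k | \<forall>j. k $ j < b ^ n. walsh_coeff b K k k * of_real ((norm (mean_char k))\<^sup>2))) \<le> e"
      by (simp only: grid_mean_density walsh_partial_sum)
  qed
qed

lemma norm_mean_char_le_1: "norm (mean_char k) \<le> 1"
proof -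
  have "norm (\<Sum>j\<in>J. vchr k (p j)) \<le> real (card J) * 1"
    by (rule sum_norm_bound) (simp add: norm_vchr)
  then have "weight * norm (\<Sum>j\<in>J. vchr k (p j)) \<le> weight * real (card J)"
    using weight_pos by (intro mult_left_mono) auto
  then show ?thesis using weight_pos by (simp add: mean_char_def norm_mult weight_sum)
qed

lemma mean_char_0: "mean_char 0 = 1"
proof -
  have "mean_char 0 = of_real (weight * real (card J))"
    by (simp add: mean_char_def vchr_def chr_def nat_digit_supp_def nat_digit_def)
  then show ?thesis by (simp only: weight_sum of_real_1)
qed

text \<open>
  This holds for every finite family of points. The partial sums over boxes
  of frequencies are cofinal among all finite partial sums, so absolute convergence identifies their
  limit with the unordered sum.
\<close>

theorem mean_square_error_formula:
  assumes summable: "(\<lambda>k. cmod (walsh_coeff b K k k)) summable_on UNIV"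
  shows "complex_of_real (LINT y:unit_cube|lborel. (shifted_error y)\<^sup>2) =
    (\<Sum>\<^sub>\<infinity>k\<in>-{0}. walsh_coeff b K k k * of_real ((norm (mean_char k))\<^sup>2))"
proof -
  define f where "f k = walsh_coeff b K k k * of_real ((norm (mean_char k))\<^sup>2)" for k
  define B where "B n = {k :: nat^'s. \<forall>j. k $ j < b ^ n}" for n
  have "norm (f k) \<le> norm (walsh_coeff b K k k)" for k
    using mult_left_mono[OF power_le_one[OF norm_ge_zero norm_mean_char_le_1], of "norm (walsh_coeff b K k k)" k 2]
    by (simp add: f_def norm_mult norm_power)
  then have "(\<lambda>k. norm (f k)) summable_on UNIV"
    by (intro Infinite_Sum.abs_summable_on_comparison_test[OF summable])
  then have "(\<lambda>k. norm (f k)) summable_on -{0}" by (rule summable_on_subset_banach) simp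
  then have "f summable_on -{0}" by (rule abs_summable_summable)
  then have "(f has_sum infsum f (-{0})) (-{0})" by (rule has_sum_infsum)
  moreover have "filterlim (\<lambda>n. B n - {0}) (finite_subsets_at_top (-{0})) sequentially"
    unfolding filterlim_finite_subsets_at_top
  proof (intro allI impI)
    fix X :: "(nat^'s) set" assume X: "finite X \<and> X \<subseteq> - {0}"
    have "\<forall>\<^sub>F n in sequentially. \<forall>k\<in>X. k \<in> B n"
      using X ex_less_base_power
      by (intro eventually_ball_finite ballI) (simp_all add: eventually_sequentially B_def)
    then show "\<forall>\<^sub>F n in sequentially. finite (B n - {0}) \<and> X \<subseteq> B n - {0} \<and> B n - {0} \<subseteq> - {0}"
      by (rule eventually_mono) (use X in \<open>auto simp: B_def finite_vec_less\<close>)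
  qed
  ultimately have lim1: "(\<lambda>n. sum f (B n - {0})) \<longlonglongrightarrow> infsum f (-{0})"
    unfolding has_sum_def by (rule filterlim_compose)
  have "(\<lambda>n. complex_of_real (pair_mean n digit_kernel) - sum f (B n)) \<longlonglongrightarrow> 0"
  proof (rule LIMSEQ_I)
    fix r :: real assume "0 < r"
    then have "0 < r / 2" by simp
    then obtain N where N: "\<And>n. n \<ge> N \<Longrightarrow> norm (complex_of_real (pair_mean n digit_kernel) - sum f (B n)) \<le> r / 2"
      by (rule pair_mean_approx[folded f_def B_def]) blast
    then have "norm (complex_of_real (pair_mean n digit_kernel) - sum f (B n) - 0) < r" if "n \<ge> N" for n
      using N[OF that] \<open>0 < r\<close> by simp
    then show "\<exists>no. \<forall>n\<ge>no. norm (complex_of_real (pair_mean n digit_kernel) - sum f (B n) - 0) < r" by blast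
  qed
  moreover have "(\<lambda>n. walsh_coeff b K 0 0 - complex_of_real (grid_mean n digit_kernel)) \<longlonglongrightarrow> walsh_coeff b K 0 0 - walsh_coeff b K 0 0"
    by (intro tendsto_intros grid_mean_limit)
  ultimately have "(\<lambda>n. (complex_of_real (pair_mean n digit_kernel) - sum f (B n))
      + (walsh_coeff b K 0 0 - complex_of_real (grid_mean n digit_kernel)) + sum f (B n - {0})) \<longlonglongrightarrow>
      0 + (walsh_coeff b K 0 0 - walsh_coeff b K 0 0) + infsum f (-{0})"
    by (intro tendsto_add lim1)
  moreover have "sum f (B n) = walsh_coeff b K 0 0 + sum f (B n - {0})" for n
  proof -
    have "0 \<in> B n" "finite (B n)" using b2 by (auto simp: B_def finite_vec_less)
    then show ?thesis by (simp add: sum.remove[of "B n" 0] f_def mean_char_0)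
  qed
  ultimately have "(\<lambda>n. complex_of_real (pair_mean n digit_kernel - grid_mean n digit_kernel)) \<longlonglongrightarrow> infsum f (-{0})"
    by simp
  moreover have "(\<lambda>n. complex_of_real (pair_mean n digit_kernel - grid_mean n digit_kernel)) \<longlonglongrightarrow>
      complex_of_real (LINT y:unit_cube|lborel. (shifted_error y)\<^sup>2)"
    using tendsto_of_real[OF shifted_error_square_limit] by (simp only: sq_error_sum)
  ultimately show ?thesis unfolding f_def[symmetric] using LIMSEQ_unique by blast
qed

end

section \<open>Symmetrized digital nets\<close>

lemma sum_image_mset_eq_product:
  assumes "finite A" "finite B"
  shows "(\<Sum>x\<in>A. image_mset (f x) (mset_set B)) = image_mset (\<lambda>(x, y). f x y) (mset_set (A \<times> B))"
  using assms(1)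
proof induction
  case (insert a A)
  have "mset_set (insert a A \<times> B) = mset_set (Pair a ` B) + mset_set (A \<times> B)"
    using insert assms(2) by (subst mset_set_Union[symmetric]) (auto intro!: arg_cong[where f = mset_set])
  also have "mset_set (Pair a ` B) = image_mset (Pair a) (mset_set B)"
    by (rule image_mset_mset_set[symmetric]) (simp add: inj_on_def)
  finally show ?case using insert by (simp add: multiset.map_comp comp_def)
qed simp

lemma symmetrize_digital_net:
  "symmetrize b (digital_net b m C) =
    image_mset (\<lambda>(n, l). vec_add b (net_point b m C n) (const_vec l))
      (mset_set ({..<b ^ m} \<times> {l. \<forall>j. l $ j < b}))"
  unfolding symmetrize_def digital_net_def
  by (simp add: multiset.map_comp comp_def sum_unfold_sum_mset[symmetric]
      sum_image_mset_eq_product finite_vec_less)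

theorem theorem20:
  fixes b m :: nat
    and C :: "(nat \<Rightarrow> nat \<Rightarrow> nat)^'s"
    and K :: "real^'s \<Rightarrow> real^'s \<Rightarrow> real"
    and H :: "(real^'s \<Rightarrow> real) set"
    and ip :: "(real^'s \<Rightarrow> real) \<Rightarrow> (real^'s \<Rightarrow> real) \<Rightarrow> real"
  assumes "b \<ge> 2" and "m \<ge> 1"
    and "\<And>j i r. r < m \<Longrightarrow> (C $ j) i r < b"
    and "rkhs unit_cube H ip K"
    and "continuous_on (unit_cube \<times> unit_cube) (\<lambda>(x, y). K x y)"
    and "set_integrable lborel unit_cube (\<lambda>x. sqrt (K x x))"
    and "(\<lambda>k. cmod (walsh_coeff b K k k)) summable_on UNIV"
  shows "complex_of_real (ms_error_seq b H ip (symmetrize b (digital_net b m C))) =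
      (\<Sum>\<^sub>\<infinity>k\<in>(dual_net b m C \<inter> {k. \<forall>j. k $ j \<in> even_digit_sum b}) - {0}.
         walsh_coeff b K k k) \<and>
    ((\<forall>z\<in>#symmetrize b (digital_net b m C). vec_sect b (vec_proj b z) = z) \<longrightarrow>
       complex_of_real (ms_error b H ip (image_mset (vec_proj b) (symmetrize b (digital_net b m C)))) =
         (\<Sum>\<^sub>\<infinity>k\<in>(dual_net b m C \<inter> {k. \<forall>j. k $ j \<in> even_digit_sum b}) - {0}.
            walsh_coeff b K k k))"
proof -
  interpret digit_base b using assms(1) by unfold_locales
  interpret rkhs unit_cube H ip K by (rule assms(4))
  define J where "J = {..<b ^ m} \<times> {l :: nat^'s. \<forall>j. l $ j < b}"
  define p where "p = (\<lambda>(n, l). vec_add b (net_point b m C n) (const_vec l))"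
  define S where "S = dual_net b m C \<inter> {k. \<forall>j. k $ j \<in> even_digit_sum b}"
  have Q: "symmetrize b (digital_net b m C) = image_mset p (mset_set J)"
    unfolding p_def J_def by (rule symmetrize_digital_net)
  have J0: "(0, 0) \<in> J" using assms(1) by (simp add: J_def)
  interpret shifted_points b H ip K J p
  proof
    show "continuous_on (unit_cube \<times> unit_cube) (\<lambda>(x, y). K x y)" by (rule assms(5))
    show "finite J" unfolding J_def by (intro finite_cartesian_product finite_vec_less) simp
    show "J \<noteq> {}" using J0 by blast
    show "p j \<in> digit_vecs" for j by (simp add: p_def vec_add_in_digit_vecs split: prod.split)
  qed
  have card_L: "card {l :: nat^'s. \<forall>j. l $ j < b} = b ^ CARD('s)"
    using sum_vec_prod[where f = "\<lambda>(_ :: 's) _. 1 :: nat" and N = b] by simp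
  have card_J: "real (card J) = real (b ^ m) * real b ^ CARD('s)"
    by (simp add: J_def card_cartesian_product card_L)
  have mean: "mean_char k = (if k \<in> S then 1 else 0)" for k
  proof -
    have "(\<Sum>j\<in>J. vchr k (p j)) = (\<Sum>n<b ^ m. vchr k (net_point b m C n)) *
        (\<Sum>l | \<forall>j. (l :: nat^'s) $ j < b. vchr k (const_vec l))"
      unfolding J_def p_def sum_product sum.cartesian_product
      by (intro sum.cong) (auto simp: vchr_vec_add)
    also have "\<dots> = (if k \<in> S then of_real (real (card J)) else 0)"
      unfolding sum_vchr_net sum_vchr_const card_J by (simp add: S_def)
    finally have sum: "(\<Sum>j\<in>J. vchr k (p j)) = (if k \<in> S then of_real (real (card J)) else 0)" .
    show ?thesis
      unfolding mean_char_def sum by (simp only: if_distrib of_real_mult[symmetric] weight_sum) simp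
  qed
  have "complex_of_real (ms_error_seq b H ip (symmetrize b (digital_net b m C))) =
      complex_of_real (LINT y:unit_cube|lborel. (shifted_error y)\<^sup>2)"
    by (simp add: ms_error_seq_def shifted_error_def Q)
  also have "\<dots> = (\<Sum>\<^sub>\<infinity>k\<in>-{0}. walsh_coeff b K k k * of_real ((norm (mean_char k))\<^sup>2))"
    by (rule mean_square_error_formula[OF assms(7)])
  also have "\<dots> = (\<Sum>\<^sub>\<infinity>k\<in>S - {0}. walsh_coeff b K k k)"
    by (rule infsum_cong_neutral) (auto simp: mean)
  finally have main: "complex_of_real (ms_error_seq b H ip (symmetrize b (digital_net b m C))) =
      (\<Sum>\<^sub>\<infinity>k\<in>S - {0}. walsh_coeff b K k k)" .
  have "ms_error b H ip (image_mset (vec_proj b) (symmetrize b (digital_net b m C))) =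
      ms_error_seq b H ip (symmetrize b (digital_net b m C))"
    if "\<forall>z\<in>#symmetrize b (digital_net b m C). vec_sect b (vec_proj b z) = z"
  proof -
    have "image_mset (\<lambda>x. dig_add b x y) (image_mset (vec_proj b) (symmetrize b (digital_net b m C))) =
        image_mset (\<lambda>z. vec_proj b (vec_add b z (vec_sect b y))) (symmetrize b (digital_net b m C))" for y
      using that by (auto simp: dig_add_def multiset.map_comp intro!: image_mset_cong)
    then show ?thesis by (simp add: ms_error_def ms_error_seq_def)
  qed
  with main show ?thesis unfolding S_def by metis
qed

end
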